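(* There exist an absolute constant $C_8>0$ and constants $C_{10}(\ell)>0$, $C_{11}(\ell)>0$ for each integer $\ell\ge1$ (depending only on $\ell$) such that, with $C_9:=16\pi e$, the following holds. Let $\mathcal{X}=\{x_1,\dots,x_s\}\subset\mathbb{R}$ form a $(\Delta,\theta,s,\ell,\tau)_{\mathbb{R}}$-clustered configuration with $\theta\ge C_{10}(\ell)\,s$ and $s\tau\Delta\le C_{11}(\ell)$. Let $\mathcal{X}=\biguplus_{j=1}^M\mathcal{C}^{(j)}$ be the partition into clusters described in the context, let $\ell^{(j)}$ be the number of nodes of $\mathcal{C}^{(j)}$, and for $m=1,\dots,\ell$ let $q_m:=\#\{1\le j\le M:\ m\le\ell^{(j)}\}$ be the number of clusters of multiplicity at least $m$. Then for each $m=1,2,\dots,\ell$ there are precisely $q_m$ eigenvalues of $\mathbf{G}(\mathcal{X})$ bounded from below by $$C_8\Bigl(\frac{\Delta}{C_9}\Bigr)^{2(m-1)}.$$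
   Context: For a set $\mathcal{X}=\{x_1,\dots,x_s\}\subset\mathbb{R}$ of $s$ pairwise distinct points, the generalized prolate matrix is $$\mathbf{G}(\mathcal{X})=\Bigl[\tfrac12\int_{-1}^{1}e^{\imath\omega(x_j-x_k)}\,d\omega\Bigr]_{j,k=1}^{s}\in\mathbb{R}^{s\times s},$$ which is symmetric positive definite. A set $\mathcal{X}=\{x_1,\dots,x_s\}\subset\mathbb{R}$ of $s$ distinct nodes forms a $(\Delta,\theta,s,\ell,\tau)_{\mathbb{R}}$-clustered configuration, for some $\Delta>0$, integers $1\le\ell\le s$, $\ell-1\le\tau$ and $\theta>0$, if for each $x_j$ there exist at most $\ell$ distinct nodes $\mathcal{X}^{(j)}=\{x_{j,k}\}_{k=1,\dots,r_j}\subset\mathcal{X}$, $1\le r_j\le\ell$, $x_{j,1}=x_j$, such that: (1) for any $y\in\mathcal{X}^{(j)}\setminus\{x_j\}$, $\Delta\le|y-x_j|\le\tau\Delta$; (2) for any $y\in\mathcal{X}\setminus\mathcal{X}^{(j)}$, $|y-x_j|\ge\theta$. Partition into clusters: in the setting of the claim, $\mathcal{X}$ admits a partition $\mathcal{X}=\biguplus_{j=1}^M\mathcal{C}^{(j)}$ such that for each $j$: $\mathcal{C}^{(j)}$ has $\ell^{(j)}\le\ell$ nodes, $\Delta\le|x-y|\le\tau\Delta$ for all distinct $x,y\in\mathcal{C}^{(j)}$, and $|x-y|\ge\theta$ for all $x\in\mathcal{C}^{(j)}$ and $y\in\mathcal{X}\setminus\mathcal{C}^{(j)}$. This is the partition used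 in the definition of $q_m$. *)

theory Defs
  imports
    "HOL-Analysis.Analysis"
    "HOL-Library.Disjoint_Sets"
    "Jordan_Normal_Form.Char_Poly"
begin

text \<open>
  A node set is given by a duplicate-free list of its elements; reordering the list only
  conjugates the matrix by a permutation. The integral is a complex number with zero imaginary
  part (lemma \<open>prolate_mat_entry\<close>), so taking its real part is merely the coercion to the reals.
\<close>

definition prolate_mat :: "real list \<Rightarrow> real mat" where
  "prolate_mat xs = mat (length xs) (length xs) (\<lambda>(j, k).
     Re (1 / 2 * integral {-1..1}
       (\<lambda>w::real. exp (\<i> * complex_of_real (w * (xs ! j - xs ! k))))))"

lemma prolate_mat_entry:
  assumes "j < length xs" "k < length xs"
  shows "complex_of_real (prolate_mat xs $$ (j, k)) =
    1 / 2 * integral {-1..1} (\<lambda>w::real. exp (\<i> * complex_of_real (w * (xs ! j - xs ! k))))"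
proof -
  define f where "f = (\<lambda>w::real. exp (\<i> * complex_of_real (w * (xs ! j - xs ! k))))"
  have "cnj (integral {-1..1} f) = integral {-1..1} (\<lambda>w. f (- w))"
    unfolding integral_cnj f_def by (simp add: exp_cnj)
  also have "\<dots> = integral {-1..1} f"
    using Henstock_Kurzweil_Integration.integral_reflect_real[of 1 "-1" f] by simp
  finally have "integral {-1..1} f \<in> \<real>"
    by (simp add: Reals_cnj_iff)
  then show ?thesis
    using assms by (simp add: prolate_mat_def f_def complex_eq_iff complex_is_Real_iff)
qed

definition clustered_config ::
    "real \<Rightarrow> real \<Rightarrow> nat \<Rightarrow> nat \<Rightarrow> real \<Rightarrow> real set \<Rightarrow> bool" where
  "clustered_config \<Delta> \<theta> s l \<tau> X \<longleftrightarrow>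
     finite X \<and> card X = s \<and> \<Delta> > 0 \<and> \<theta> > 0 \<and> 1 \<le> l \<and> l \<le> s \<and> real l - 1 \<le> \<tau> \<and>
     (\<forall>x\<in>X. \<exists>Y\<subseteq>X. x \<in> Y \<and> card Y \<le> l \<and>
        (\<forall>y\<in>Y - {x}. \<Delta> \<le> \<bar>y - x\<bar> \<and> \<bar>y - x\<bar> \<le> \<tau> * \<Delta>) \<and>
        (\<forall>y\<in>X - Y. \<bar>y - x\<bar> \<ge> \<theta>))"

definition cluster_partition ::
    "real \<Rightarrow> real \<Rightarrow> nat \<Rightarrow> real \<Rightarrow> real set \<Rightarrow> real set set \<Rightarrow> bool" where
  "cluster_partition \<Delta> \<theta> l \<tau> X P \<longleftrightarrow>
     partition_on X P \<and>
     (\<forall>C\<in>P. card C \<le> l \<and>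
        (\<forall>x\<in>C. \<forall>y\<in>C. x \<noteq> y \<longrightarrow> \<Delta> \<le> \<bar>x - y\<bar> \<and> \<bar>x - y\<bar> \<le> \<tau> * \<Delta>) \<and>
        (\<forall>x\<in>C. \<forall>y\<in>X - C. \<bar>x - y\<bar> \<ge> \<theta>))"

definition num_clusters_ge :: "real set set \<Rightarrow> nat \<Rightarrow> nat" where
  "num_clusters_ge P m = card {C \<in> P. m \<le> card C}"

text \<open>Eigenvalues with algebraic multiplicity (which is the geometric one for symmetric matrices).\<close>

definition eigenvalue_mset :: "real mat \<Rightarrow> real multiset" where
  "eigenvalue_mset A = proots (char_poly A)"

text \<open>
  For each \<open>m = 1, \<dots>, l\<close> there are precisely \<open>q m\<close> eigenvalues of \<open>A\<close> bounded from below
  by \<open>b m\<close>: the eigenvalues split into groups \<open>E 1, \<dots>, E l\<close>, the group of level \<open>m\<close> has exactly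
  \<open>q m\<close> members, and these are at least \<open>b m\<close>. The levels must be disjoint groups: when \<open>b\<close>
  decreases in \<open>m\<close>, an eigenvalue of level \<open>m\<close> exceeds all later bounds as well, so \<open>q m\<close> is
  not the cardinality of the set of all eigenvalues above \<open>b m\<close>.
\<close>

definition eigenvalue_levels ::
    "real mat \<Rightarrow> nat \<Rightarrow> (nat \<Rightarrow> nat) \<Rightarrow> (nat \<Rightarrow> real) \<Rightarrow> bool" where
  "eigenvalue_levels A l q b \<longleftrightarrow>
     (\<exists>E :: nat \<Rightarrow> real multiset.
        eigenvalue_mset A = (\<Sum>m = 1..l. E m) \<and>
        (\<forall>m\<in>{1..l}. size (E m) = q m \<and> (\<forall>ev \<in># E m. ev \<ge> b m)))"

end

theory Submission
  imports Defs "Jordan_Normal_Form.Schur_Decomposition"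
begin

text \<open>
  The quadratic form of the prolate matrix is an energy: for a real coefficient vector \<open>c\<close>,
  \<open>\<Sum>j k. c\<^sub>j c\<^sub>k G\<^sub>j\<^sub>k = 1/2 \<integral>\<^sub>-\<^sub>1\<^sup>1 |f|\<^sup>2\<close> with the exponential sum \<open>f w = \<Sum>j. c\<^sub>j exp (\<i> w x\<^sub>j)\<close>.
  Keep \<open>min m |C|\<close> nodes of every cluster \<open>C\<close>. The vectors supported on the kept nodes form a
  coordinate subspace of dimension \<open>\<Sum>C. min m |C| = q 1 + \<dots> + q m\<close>. If the form is at least
  \<open>b m = 1/4 (\<Delta> / 16\<pi>e)\<^bsup>2(m-1)\<^esup>\<close> times the squared norm on it, then by the Courant-Fischer principle
  (\<open>courant_fischer_count\<close>) at least \<open>q 1 + \<dots> + q m\<close> eigenvalues are \<open>\<ge> b m\<close>. This for all \<open>m\<close> lets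
  a greedy choice hand out \<open>q m\<close> fresh eigenvalues to each level \<open>m\<close> (\<open>multiset_split_levels\<close>),
  and since \<open>q 1 + \<dots> + q l\<close> is the number of nodes, nothing is left over.

  The lower bound on the subspace has two ingredients.

  Different clusters are almost orthogonal (\<open>energy_separated_clusters\<close>). Modulated to frequency 0,
  the part \<open>p\<close> of \<open>f\<close> that belongs to one cluster is an exponential sum with at most \<open>l\<close> terms and
  frequencies in \<open>[-1, 1]\<close>. Such sums behave like polynomials of bounded degree: their derivative
  and their maximum are controlled by their \<open>L\<^sup>2\<close> norm, with constants that depend on \<open>l\<close> only and
  not on how close together the frequencies are (\<open>exp_sum_bernstein\<close>, \<open>exp_sum_nikolskii\<close>).
  Integration by parts against the fast factor \<open>exp (\<i> w (a - b))\<close> then bounds the inner product of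
  the parts of two clusters by \<open>K(l) / \<theta>\<close> times the product of their norms. Summation over the pairs of
  at most \<open>s\<close> clusters shows that at least half of the total energy survives once \<open>\<theta> \<ge> 2 K(l) s\<close>.

  A single cluster \<open>Y\<close> with \<open>N + 1\<close> nodes has energy at least \<open>(\<Delta> / 16\<pi>e)\<^bsup>2N\<^esup> \<Sum>|c\<^sub>x|\<^sup>2\<close>
  (\<open>single_cluster_energy\<close>). The first-order difference operator \<open>g(w + t) - exp (\<i> t s) g(w)\<close>
  kills the frequency \<open>s\<close> and at most doubles the \<open>L\<^sup>2\<close> norm. Applied with step \<open>t = 1/N\<close> for every
  node except \<open>x\<close>, these operators use up an interval of length \<open>1\<close>, multiply the norm by at most
  \<open>2\<^sup>N\<close>, and leave only \<open>c\<^sub>x\<close> times \<open>\<Prod>s. (exp (\<i> t x) - exp (\<i> t s))\<close>. This product is at least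
  \<open>(\<Delta> / 4e)\<^sup>N\<close> in modulus, because every factor is a chord of length at least
  \<open>t |x - s| / 2\<close>, the distances from \<open>x\<close> to the \<open>N\<close> other nodes have product at least \<open>N! (\<Delta>/2)\<^sup>N\<close>,
  and \<open>N! \<ge> (N/e)\<^sup>N\<close>.
\<close>

section \<open>Linear systems and multisets\<close>

text \<open>
  Gaussian elimination, one equation at a time: an equation with a nonzero coefficient at \<open>j0\<close> is
  used to eliminate the unknown \<open>j0\<close> from the remaining equations.
\<close>

lemma homogeneous_system_nontrivial:
  fixes a :: "'i \<Rightarrow> 'j \<Rightarrow> 'a::field"
  assumes "finite I" "finite J" "card I < card J"
  shows "\<exists>x. (\<exists>j\<in>J. x j \<noteq> 0) \<and> (\<forall>j. j \<notin> J \<longrightarrow> x j = 0) \<and> (\<forall>i\<in>I. (\<Sum>j\<in>J. a i j * x j) = 0)"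
  using assms
proof (induction I arbitrary: J a rule: finite_induct)
  case empty
  then have "J \<noteq> {}" by auto
  then show ?case by (intro exI[of _ "\<lambda>j. if j \<in> J then 1 else 0"]) auto
next
  case (insert k I)
  show ?case
  proof (cases "\<exists>j0\<in>J. a k j0 \<noteq> 0")
    case False
    then have zero: "(\<Sum>j\<in>J. a k j * x j) = 0" for x by simp
    have "card I < card J" using insert.prems insert.hyps by simp
    from insert.IH[OF insert.prems(1) this, of a] obtain x where
      "\<exists>j\<in>J. x j \<noteq> 0" "\<forall>j. j \<notin> J \<longrightarrow> x j = 0" "\<forall>i\<in>I. (\<Sum>j\<in>J. a i j * x j) = 0" by auto
    then show ?thesis using zero[of x] by (intro exI[of _ x]) auto
  next
    case True
    then obtain j0 where j0: "j0 \<in> J" "a k j0 \<noteq> 0" by blast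
    \<comment> \<open>the system for the other unknowns after substituting the solution of equation \<open>k\<close> for \<open>j0\<close>\<close>
    define b where "b = (\<lambda>i j. a i j - a i j0 * a k j / a k j0)"
    have "card I < card (J - {j0})" using insert j0 by simp
    then obtain x where x: "\<exists>j\<in>J - {j0}. x j \<noteq> 0" "\<forall>j. j \<notin> J - {j0} \<longrightarrow> x j = 0"
      "\<forall>i\<in>I. (\<Sum>j\<in>J - {j0}. b i j * x j) = 0"
      using insert.IH[of "J - {j0}" b] insert.prems by auto
    define r where "r = (\<Sum>j\<in>J - {j0}. a k j * x j)"
    define z where "z = x(j0 := - r / a k j0)"
    have split: "(\<Sum>j\<in>J. a i j * z j) = a i j0 * (- r / a k j0) + (\<Sum>j\<in>J - {j0}. a i j * x j)" for i
      using j0 insert.prems by (subst sum.remove[of J j0]) (auto simp: z_def intro!: sum.cong)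
    have "(\<Sum>j\<in>J. a i j * z j) = 0" if "i \<in> insert k I" for i
    proof (cases "i = k")
      case True
      then show ?thesis using split[of k] j0 by (simp add: r_def)
    next
      case False
      then have "i \<in> I" using that by simp
      then have "0 = (\<Sum>j\<in>J - {j0}. b i j * x j)" using x(3) by simp
      also have "\<dots> = (\<Sum>j\<in>J - {j0}. a i j * x j) - (\<Sum>j\<in>J - {j0}. a i j0 / a k j0 * (a k j * x j))"
        by (simp add: b_def left_diff_distrib sum_subtractf mult.assoc)
      also have "\<dots> = (\<Sum>j\<in>J - {j0}. a i j * x j) - a i j0 / a k j0 * r"
        by (simp add: r_def sum_distrib_left)
      finally show ?thesis using split[of i] by simp
    qed
    moreover have "\<exists>j\<in>J. z j \<noteq> 0" using x(1) by (auto simp: z_def)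
    moreover have "\<forall>j. j \<notin> J \<longrightarrow> z j = 0" using x(2) j0 by (auto simp: z_def)
    ultimately show ?thesis by blast
  qed
qed

lemma multiset_take_subset:
  assumes "n \<le> size M"
  shows "\<exists>N. N \<subseteq># M \<and> size N = n"
proof -
  obtain xs where xs: "M = mset xs" by (metis ex_mset)
  have "M = mset (take n xs) + mset (drop n xs)" unfolding xs mset_append[symmetric] by simp
  then show ?thesis using assms xs by (intro exI[of _ "mset (take n xs)"]) auto
qed

text \<open>
  Greedy choice: the earlier levels have consumed at most \<open>q 1 + \<dots> + q (m - 1)\<close> elements, so at
  least \<open>q m\<close> of the elements that are \<open>\<ge> b m\<close> are still available for level \<open>m\<close>.
\<close>

lemma multiset_split_levels:
  fixes M :: "'a::linorder multiset" and l :: nat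
  assumes "\<And>m. m \<in> {1..l} \<Longrightarrow> (\<Sum>k=1..m. q k) \<le> size (filter_mset (\<lambda>x. x \<ge> b m) M)"
    and total: "size M = (\<Sum>k=1..l. q k)"
  shows "\<exists>E. M = (\<Sum>m=1..l. E m) \<and> (\<forall>m\<in>{1..l}. size (E m) = q m \<and> (\<forall>x\<in>#E m. x \<ge> b m))"
proof -
  have "\<exists>E. (\<Sum>m=1..n. E m) \<subseteq># M \<and> (\<forall>m\<in>{1..n}. size (E m) = q m \<and> (\<forall>x\<in>#E m. x \<ge> b m))"
    if "n \<le> l" for n
    using that
  proof (induction n)
    case 0
    then show ?case by simp
  next
    case (Suc n)
    then obtain E where E: "(\<Sum>m=1..n. E m) \<subseteq># M"
      "\<forall>m\<in>{1..n}. size (E m) = q m \<and> (\<forall>x\<in>#E m. x \<ge> b m)" by auto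
    let ?S = "\<Sum>m=1..n. E m" and ?F = "filter_mset (\<lambda>x. x \<ge> b (Suc n))"
    have "size ?S = (\<Sum>k=1..n. q k)" using E(2) by (simp add: size_multiset_sum)
    then have "size (?F ?S) \<le> (\<Sum>k=1..n. q k)"
      by (metis size_filter_mset_lesseq)
    moreover have "(\<Sum>k=1..Suc n. q k) \<le> size (?F M)" using assms(1)[of "Suc n"] Suc.prems by simp
    moreover have "size (?F (M - ?S)) = size (?F M) - size (?F ?S)"
      using E(1) by (simp add: filter_diff_mset size_Diff_submset multiset_filter_mono)
    ultimately have "q (Suc n) \<le> size (?F (M - ?S))" by simp
    then obtain N where N: "N \<subseteq># ?F (M - ?S)" "size N = q (Suc n)"
      using multiset_take_subset by blast
    have NM: "N \<subseteq># M - ?S" using N(1) multiset_filter_subset subset_mset.order_trans by blast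
    define E' where "E' = E(Suc n := N)"
    have "(\<Sum>m=1..Suc n. E' m) = ?S + N" by (simp add: E'_def)
    then have "(\<Sum>m=1..Suc n. E' m) \<subseteq># M"
      using NM E(1) by (simp add: add.commute subset_mset.le_diff_conv2)
    moreover have "x \<ge> b (Suc n)" if "x \<in># N" for x
      using mset_subset_eqD[OF N(1) that] unfolding set_mset_filter by blast
    ultimately show ?case using E(2) N(2)
      by (intro exI[of _ E']) (auto simp: E'_def)
  qed
  \<comment> \<open>by the total size, the levels exhaust the multiset\<close>
  from this[of l] obtain E where E: "(\<Sum>m=1..l. E m) \<subseteq># M"
      "\<forall>m\<in>{1..l}. size (E m) = q m \<and> (\<forall>x\<in>#E m. x \<ge> b m)" by auto
  have "size (\<Sum>m=1..l. E m) = size M" using E(2) total by (simp add: size_multiset_sum)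
  then have "M = (\<Sum>m=1..l. E m)" using E(1) mset_subset_size[of "\<Sum>m=1..l. E m" M]
    by (auto simp: subset_mset.le_less)
  then show ?thesis using E(2) by blast
qed

section \<open>Spectral theory of real symmetric matrices\<close>

text \<open>
  Over the complex numbers there is an eigenvector \<open>x + \<i> y\<close> with some eigenvalue \<open>\<mu>\<close>. Comparing
  \<open>x \<bullet> A y\<close> with \<open>A x \<bullet> y\<close> gives \<open>Im \<mu> (|x|\<^sup>2 + |y|\<^sup>2) = 0\<close>; hence \<open>\<mu>\<close> is real and \<open>x\<close> or \<open>y\<close> is a real
  eigenvector.
\<close>

lemma symmetric_real_eigenvector:
  fixes A :: "real mat"
  assumes A: "A \<in> carrier_mat n n" and sym: "transpose_mat A = A" and n: "n > 0"
  shows "\<exists>e v. v \<in> carrier_vec n \<and> v \<noteq> 0\<^sub>v n \<and> A *\<^sub>v v = e \<cdot>\<^sub>v v"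
proof -
  define cA where "cA = map_mat complex_of_real A"
  have cA: "cA \<in> carrier_mat n n" using A by (simp add: cA_def)
  have "degree (char_poly cA) = n" using degree_monic_char_poly[OF cA] by simp
  then have "\<not> constant (poly (char_poly cA))" using n by (simp add: constant_degree)
  then obtain \<mu> where "poly (char_poly cA) \<mu> = 0" using fundamental_theorem_of_algebra by blast
  then have "eigenvalue cA \<mu>" using eigenvalue_root_char_poly[OF cA] by simp
  then obtain v where v: "v \<in> carrier_vec n" "v \<noteq> 0\<^sub>v n" "cA *\<^sub>v v = \<mu> \<cdot>\<^sub>v v"
    using cA unfolding eigenvalue_def eigenvector_def by auto
  define x y where "x = vec n (\<lambda>i. Re (v $ i))" and "y = vec n (\<lambda>i. Im (v $ i))"
  have xy: "x \<in> carrier_vec n" "y \<in> carrier_vec n" by (auto simp: x_def y_def)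
  have entry: "(\<Sum>j<n. complex_of_real (A $$ (i, j)) * v $ j) = \<mu> * v $ i" if "i < n" for i
  proof -
    have "(cA *\<^sub>v v) $ i = (\<Sum>j<n. complex_of_real (A $$ (i, j)) * v $ j)"
      using that A v(1) by (auto simp: cA_def scalar_prod_def atLeast0LessThan intro!: sum.cong)
    then show ?thesis using v(3) v(1) that by simp
  qed
  have Ax: "A *\<^sub>v x = Re \<mu> \<cdot>\<^sub>v x - Im \<mu> \<cdot>\<^sub>v y"
  proof (rule eq_vecI)
    fix i assume "i < dim_vec (Re \<mu> \<cdot>\<^sub>v x - Im \<mu> \<cdot>\<^sub>v y)"
    then have i: "i < n" by (simp add: y_def)
    have "(A *\<^sub>v x) $ i = (\<Sum>j<n. A $$ (i, j) * Re (v $ j))"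
      using i A by (auto simp: x_def scalar_prod_def atLeast0LessThan intro!: sum.cong)
    also have "\<dots> = Re (\<mu> * v $ i)" using arg_cong[OF entry[OF i], of Re] by simp
    finally show "(A *\<^sub>v x) $ i = (Re \<mu> \<cdot>\<^sub>v x - Im \<mu> \<cdot>\<^sub>v y) $ i" using i by (simp add: x_def y_def)
  qed (use A in \<open>auto simp: y_def\<close>)
  have Ay: "A *\<^sub>v y = Im \<mu> \<cdot>\<^sub>v x + Re \<mu> \<cdot>\<^sub>v y"
  proof (rule eq_vecI)
    fix i assume "i < dim_vec (Im \<mu> \<cdot>\<^sub>v x + Re \<mu> \<cdot>\<^sub>v y)"
    then have i: "i < n" by (simp add: y_def)
    have "(A *\<^sub>v y) $ i = (\<Sum>j<n. A $$ (i, j) * Im (v $ j))"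
      using i A by (auto simp: y_def scalar_prod_def atLeast0LessThan intro!: sum.cong)
    also have "\<dots> = Im (\<mu> * v $ i)" using arg_cong[OF entry[OF i], of Im] by simp
    finally show "(A *\<^sub>v y) $ i = (Im \<mu> \<cdot>\<^sub>v x + Re \<mu> \<cdot>\<^sub>v y) $ i" using i by (simp add: x_def y_def)
  qed (use A in \<open>auto simp: y_def\<close>)
  have "x \<bullet> (A *\<^sub>v y) = (A *\<^sub>v x) \<bullet> y"
    using transpose_vec_mult_scalar[OF A xy(2) xy(1)] sym A xy
    by (metis)
  moreover have "x \<bullet> (A *\<^sub>v y) = Im \<mu> * (x \<bullet> x) + Re \<mu> * (x \<bullet> y)"
    unfolding Ay using xy by (simp add: scalar_prod_add_distrib[of _ n])
  moreover have "(A *\<^sub>v x) \<bullet> y = Re \<mu> * (x \<bullet> y) - Im \<mu> * (y \<bullet> y)"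
    unfolding Ax using xy by (simp add: minus_scalar_prod_distrib[of _ n])
  ultimately have im: "Im \<mu> * (x \<bullet> x + y \<bullet> y) = 0" by (simp add: algebra_simps)
  have nz: "x \<noteq> 0\<^sub>v n \<or> y \<noteq> 0\<^sub>v n"
  proof (rule ccontr)
    assume "\<not> ?thesis"
    then have z: "x = 0\<^sub>v n" "y = 0\<^sub>v n" by auto
    have "v = 0\<^sub>v n"
    proof (rule eq_vecI)
      fix i assume i: "i < dim_vec (0\<^sub>v n :: complex vec)"
      then have "x $ i = 0" "y $ i = 0" using z by auto
      then show "v $ i = 0\<^sub>v n $ i" using i by (simp add: x_def y_def complex_eq_iff)
    qed (use v in auto)
    then show False using v by simp
  qed
  have pos: "z \<bullet> z \<ge> 0" "z \<noteq> 0\<^sub>v n \<Longrightarrow> z \<bullet> z > 0" if "z \<in> carrier_vec n" for z :: "real vec"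
    using conjugate_square_ge_0_vec[of z] conjugate_square_greater_0_vec[OF that] that by auto
  have "x \<bullet> x + y \<bullet> y > 0" using nz pos xy by (meson add_nonneg_pos add_pos_nonneg)
  with im have "Im \<mu> = 0" by simp
  with Ax Ay xy have "A *\<^sub>v x = Re \<mu> \<cdot>\<^sub>v x" "A *\<^sub>v y = Re \<mu> \<cdot>\<^sub>v y" by auto
  then show ?thesis using nz xy by blast
qed

text \<open>
  Gram-Schmidt applied to a basis that starts with \<open>v\<close>, followed by normalization.
\<close>

lemma orthogonal_completion:
  fixes v :: "real vec"
  assumes v: "v \<in> carrier_vec n" and v0: "v \<noteq> 0\<^sub>v n" and n: "n > 0"
  shows "\<exists>W c. W \<in> carrier_mat n n \<and> transpose_mat W * W = 1\<^sub>m n \<and> col W 0 = c \<cdot>\<^sub>v v"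
proof -
  interpret cof_vec_space n "TYPE(real)" .
  define b where "b = basis_completion v"
  define ws where "ws = gram_schmidt n b"
  note bc = basis_completion[OF v v0, folded b_def]
  obtain vs where bv: "b = v # vs" using bc(6,7) n by (cases b) auto
  have ws: "set ws \<subseteq> carrier_vec n" "corthogonal ws" "length ws = n"
    using gram_schmidt_result[OF bc(2,4,5) refl, folded ws_def] bc(6) by auto
  have hd: "hd ws = v" using gram_schmidt_hd[OF v, of vs, folded bv] by (simp add: ws_def)
  have wsi: "ws ! i \<in> carrier_vec n" if "i < n" for i using ws that by auto
  have orth: "(ws ! i \<bullet> ws ! j = 0) \<longleftrightarrow> i \<noteq> j" if "i < n" "j < n" for i j
    using corthogonalD[OF ws(2), of i j] that ws(3) by simp
  have pos: "ws ! i \<bullet> ws ! i > 0" if "i < n" for i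
    using conjugate_square_ge_0_vec[of "ws ! i"] orth[OF that that] by (simp add: less_le)
  define c where "c = (\<lambda>i. 1 / sqrt (ws ! i \<bullet> ws ! i))"
  define W where "W = mat_of_cols n (map (\<lambda>i. c i \<cdot>\<^sub>v (ws ! i)) [0..<n])"
  have W: "W \<in> carrier_mat n n" unfolding W_def by (auto intro: mat_of_cols_carrier)
  have colW: "col W i = c i \<cdot>\<^sub>v (ws ! i)" if "i < n" for i
    unfolding W_def using that wsi by (subst col_mat_of_cols) auto
  have "transpose_mat W * W = 1\<^sub>m n"
  proof (rule eq_matI)
    fix i j assume "i < dim_row (1\<^sub>m n :: real mat)" "j < dim_col (1\<^sub>m n :: real mat)"
    then have ij: "i < n" "j < n" by auto
    have "(transpose_mat W * W) $$ (i, j) = col W i \<bullet> col W j" using ij W by simp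
    also have "\<dots> = c i * (c j * (ws ! i \<bullet> ws ! j))"
      using wsi[OF ij(1)] wsi[OF ij(2)] by (simp add: colW ij)
    also have "\<dots> = (if i = j then 1 else 0)"
      using orth[OF ij] pos[OF ij(1)] by (auto simp: c_def)
    finally show "(transpose_mat W * W) $$ (i, j) = 1\<^sub>m n $$ (i, j)" using ij by simp
  qed (use W in auto)
  moreover have "ws ! 0 = v" using hd ws(3) n by (metis hd_conv_nth length_0_conv less_irrefl)
  ultimately show ?thesis using W colW[OF n] by auto
qed

text \<open>
  Deflation: in an orthonormal basis that starts with a unit eigenvector, the matrix becomes block
  diagonal with blocks of sizes \<open>1\<close> and \<open>n - 1\<close>, symmetry clearing the first row together with the
  first column.
\<close>

lemma real_spectral_theorem:
  fixes A :: "real mat"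
  assumes "A \<in> carrier_mat n n" and "transpose_mat A = A"
  shows "\<exists>U. U \<in> carrier_mat n n \<and> transpose_mat U * U = 1\<^sub>m n \<and>
    diagonal_mat (transpose_mat U * A * U)"
  using assms
proof (induction n arbitrary: A)
  case 0
  then show ?case by (intro exI[of _ "1\<^sub>m 0"]) (auto simp: diagonal_mat_def)
next
  case (Suc n)
  note A = Suc.prems(1) and sym = Suc.prems(2)
  obtain e v where v: "v \<in> carrier_vec (Suc n)" "v \<noteq> 0\<^sub>v (Suc n)" "A *\<^sub>v v = e \<cdot>\<^sub>v v"
    using symmetric_real_eigenvector[OF A sym] by auto
  obtain W c where W: "W \<in> carrier_mat (Suc n) (Suc n)" "transpose_mat W * W = 1\<^sub>m (Suc n)"
      "col W 0 = c \<cdot>\<^sub>v v"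
    using orthogonal_completion[OF v(1,2)] by auto
  let ?T = transpose_mat
  have WT: "?T W \<in> carrier_mat (Suc n) (Suc n)" using W by simp
  define B where "B = ?T W * A * W"
  have B: "B \<in> carrier_mat (Suc n) (Suc n)" using W A by (auto simp: B_def)
  have Bsym: "?T B = B" unfolding B_def
    using W A WT sym
    by (simp add: transpose_mult[of _ "Suc n" "Suc n" _ "Suc n"] assoc_mult_mat[of _ "Suc n" "Suc n" _ "Suc n" _ "Suc n"])
  have col0: "B $$ (i, 0) = (if i = 0 then e else 0)" if i: "i < Suc n" for i
  proof -
    have "B = ?T W * (A * W)" unfolding B_def using W A WT by simp
    then have "B $$ (i, 0) = (?T W * (A * W)) $$ (i, 0)" by simp
    also have "\<dots> = row (?T W) i \<bullet> col (A * W) 0" using i W A by (subst index_mult_mat) auto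
    also have "col (A * W) 0 = A *\<^sub>v col W 0" using A W by (subst col_mult2) auto
    also have "\<dots> = e \<cdot>\<^sub>v col W 0"
      unfolding W(3) using A v by (simp add: mult_mat_vec smult_smult_assoc mult.commute)
    also have "row (?T W) i \<bullet> (e \<cdot>\<^sub>v col W 0) = e * (row (?T W) i \<bullet> col W 0)"
      by (rule scalar_prod_smult_distrib[of _ "Suc n"]) (use W i v in auto)
    also have "row (?T W) i \<bullet> col W 0 = (?T W * W) $$ (i, 0)"
      using i W by (subst index_mult_mat) auto
    finally show ?thesis using i W(2) by simp
  qed
  have row0: "B $$ (0, i) = (if i = 0 then e else 0)" if i: "i < Suc n" for i
    using col0[OF i] arg_cong[OF Bsym, of "\<lambda>M. M $$ (i, 0)"] B i by simp
  define E where "E = mat 1 1 (\<lambda>_. e)"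
  define C where "C = mat n n (\<lambda>(i, j). B $$ (Suc i, Suc j))"
  have E: "E \<in> carrier_mat 1 1" and C: "C \<in> carrier_mat n n" by (auto simp: E_def C_def)
  have Bblock: "B = four_block_mat E (0\<^sub>m 1 n) (0\<^sub>m n 1) C"
    using B by (intro eq_matI) (auto simp: E_def C_def col0 row0)
  have "?T C = C"
  proof (rule eq_matI)
    fix i j assume "i < dim_row C" "j < dim_col C"
    then show "?T C $$ (i, j) = C $$ (i, j)"
      using arg_cong[OF Bsym, of "\<lambda>M. M $$ (Suc i, Suc j)"] B by (simp add: C_def)
  qed (auto simp: C_def)
  from Suc.IH[OF C this] obtain V where V: "V \<in> carrier_mat n n" "?T V * V = 1\<^sub>m n"
    "diagonal_mat (?T V * C * V)" by auto
  define F where "F = four_block_mat (1\<^sub>m 1) (0\<^sub>m 1 n) (0\<^sub>m n 1) V"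
  have F: "F \<in> carrier_mat (Suc n) (Suc n)" using V by (auto simp: F_def)
  have FT: "?T F = four_block_mat (1\<^sub>m 1) (0\<^sub>m 1 n) (0\<^sub>m n 1) (?T V)"
    unfolding F_def using V by (subst transpose_four_block_mat[of _ 1 1 _ n _ n]) auto
  have FTc: "?T F \<in> carrier_mat (Suc n) (Suc n)" using F by simp
  have "?T F * F = four_block_mat (1\<^sub>m 1) (0\<^sub>m 1 n) (0\<^sub>m n 1) (1\<^sub>m n)"
    unfolding FT unfolding F_def using V
    by (subst mult_four_block_mat[of _ 1 1 _ n _ n _ _ 1 _ n]) auto
  then have FF: "?T F * F = 1\<^sub>m (Suc n)" by (simp add: four_block_one_mat)
  have "?T F * B = four_block_mat E (0\<^sub>m 1 n) (0\<^sub>m n 1) (?T V * C)"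
    unfolding FT unfolding Bblock using V C E
    by (subst mult_four_block_mat[of _ 1 1 _ n _ n _ _ 1 _ n]) auto
  then have FBF: "?T F * B * F = four_block_mat E (0\<^sub>m 1 n) (0\<^sub>m n 1) (?T V * C * V)"
    unfolding F_def using V C E
    by (simp, subst mult_four_block_mat[of _ 1 1 _ n _ n _ _ 1 _ n]) auto
  define U where "U = W * F"
  have U: "U \<in> carrier_mat (Suc n) (Suc n)" using W F by (auto simp: U_def)
  have UT: "?T U = ?T F * ?T W" unfolding U_def by (rule transpose_mult[OF W(1) F])
  note assoc = assoc_mult_mat[of _ "Suc n" "Suc n" _ "Suc n" _ "Suc n"]
  have "?T U * U = ?T F * ((?T W * W) * F)"
    unfolding UT unfolding U_def using W(1) F WT FTc by (simp add: assoc)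
  also have "\<dots> = 1\<^sub>m (Suc n)" using W(2) FF F by simp
  finally have UU: "?T U * U = 1\<^sub>m (Suc n)" .
  have "?T U * A * U = ?T F * B * F"
    unfolding UT B_def unfolding U_def using W(1) F WT FTc A by (simp add: assoc)
  moreover have "diagonal_mat (?T F * B * F)"
    unfolding FBF diagonal_mat_def using V C E
    by (auto simp: diagonal_mat_def)
  ultimately show ?case using U UU by auto
qed

text \<open>
  The spectral theorem in coordinates: \<open>u i\<close> is the \<open>i\<close>-th vector of an orthonormal eigenbasis,
  so the form and the norm are diagonal in the coordinates \<open>\<Sum>j. u i j * c j\<close>.
\<close>

lemma symmetric_diagonal_form:
  fixes A :: "real mat"
  assumes A: "A \<in> carrier_mat n n" and sym: "transpose_mat A = A"
  shows "\<exists>e u. eigenvalue_mset A = image_mset e (mset_set {..<n}) \<and>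
    (\<forall>c. (\<Sum>j<n. \<Sum>k<n. c j * c k * A $$ (j, k)) = (\<Sum>i<n. e i * (\<Sum>j<n. u i j * c j)\<^sup>2) \<and>
         (\<Sum>j<n. (c j)\<^sup>2) = (\<Sum>i<n. (\<Sum>j<n. u i j * c j)\<^sup>2))"
proof -
  let ?T = transpose_mat
  obtain U where U: "U \<in> carrier_mat n n" "?T U * U = 1\<^sub>m n" "diagonal_mat (?T U * A * U)"
    using real_spectral_theorem[OF A sym] by auto
  have UT: "?T U \<in> carrier_mat n n" using U by simp
  have UU: "U * ?T U = 1\<^sub>m n" using mat_mult_left_right_inverse[OF UT U(1) U(2)] .
  define D where "D = ?T U * A * U"
  have D: "D \<in> carrier_mat n n" using U A UT by (auto simp: D_def)
  define e where "e = (\<lambda>i. D $$ (i, i))"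
  have offdiag: "D $$ (i, j) = 0" if "i < n" "j < n" "i \<noteq> j" for i j
    using U(3) that D unfolding D_def[symmetric] diagonal_mat_def by auto
  note assoc = assoc_mult_mat[of _ n n _ n _ n]
  have "U * D * ?T U = (U * ?T U) * A * (U * ?T U)"
    unfolding D_def using U(1) UT A by (simp add: assoc)
  then have AD: "A = U * D * ?T U" using UU A by simp
  have "similar_mat A D"
    unfolding similar_mat_def
    by (intro exI[of _ U] exI[of _ "?T U"] similar_mat_witI[of _ _ n]) (use U UU AD A D UT in auto)
  then have "char_poly A = char_poly D" by (rule char_poly_similar)
  also have "upper_triangular D" using offdiag D by (intro upper_triangularI) auto
  then have "char_poly D = (\<Prod>a\<leftarrow>diag_mat D. [:- a, 1:])" by (rule char_poly_upper_triangular[OF D])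
  also have "diag_mat D = map e [0..<n]" using D by (simp add: diag_mat_def e_def)
  also have "(\<Prod>a\<leftarrow>map e [0..<n]. [:- a, 1:]) = (\<Prod>i<n. [:- e i, 1:])"
    by (simp add: prod.list_conv_set_nth atLeast0LessThan)
  finally have "eigenvalue_mset A = (\<Sum>i<n. {#e i#})"
    unfolding eigenvalue_mset_def by (simp add: proots_prod)
  then have eig: "eigenvalue_mset A = image_mset e (mset_set {..<n})"
    by (simp add: sum_unfold_sum_mset)
  define u where "u = (\<lambda>i j. U $$ (j, i))"
  have "(\<Sum>j<n. \<Sum>k<n. c j * c k * A $$ (j, k)) = (\<Sum>i<n. e i * (\<Sum>j<n. u i j * c j)\<^sup>2) \<and>
         (\<Sum>j<n. (c j)\<^sup>2) = (\<Sum>i<n. (\<Sum>j<n. u i j * c j)\<^sup>2)" for c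
  proof -
    define v where "v = vec n c"
    define x where "x = ?T U *\<^sub>v v"
    have v: "v \<in> carrier_vec n" and x: "x \<in> carrier_vec n" using UT by (auto simp: v_def x_def)
    have xi: "x $ i = (\<Sum>j<n. u i j * c j)" if "i < n" for i
      using that U by (auto simp: x_def v_def u_def scalar_prod_def atLeast0LessThan intro!: sum.cong)
    have vx: "v = U *\<^sub>v x"
      unfolding x_def using U(1) UT v UU by (simp add: assoc_mult_mat_vec[symmetric])
    have move: "v \<bullet> (U *\<^sub>v w) = x \<bullet> w" if "w \<in> carrier_vec n" for w
      unfolding x_def using transpose_vec_mult_scalar[OF U(1) that v] by simp
    have "v \<bullet> v = (\<Sum>j<n. (c j)\<^sup>2)"
      by (simp add: v_def scalar_prod_def atLeast0LessThan power2_eq_square)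
    moreover have "v \<bullet> v = x \<bullet> x" using move[OF x] vx by simp
    moreover have "x \<bullet> x = (\<Sum>i<n. (\<Sum>j<n. u i j * c j)\<^sup>2)"
      using x by (simp add: scalar_prod_def atLeast0LessThan power2_eq_square xi)
    moreover have "v \<bullet> (A *\<^sub>v v) = (\<Sum>j<n. \<Sum>k<n. c j * c k * A $$ (j, k))"
      using A by (auto simp: v_def scalar_prod_def atLeast0LessThan sum_distrib_left mult_ac intro!: sum.cong)
    moreover have "A *\<^sub>v v = U *\<^sub>v (D *\<^sub>v x)"
    proof -
      have "A *\<^sub>v v = (U * D * ?T U) *\<^sub>v v" using AD by simp
      also have "\<dots> = (U * D) *\<^sub>v x"
        unfolding x_def using U(1) UT D v by (intro assoc_mult_mat_vec[of _ n n _ n]) auto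
      also have "\<dots> = U *\<^sub>v (D *\<^sub>v x)"
        using U(1) D x by (intro assoc_mult_mat_vec[of _ n n _ n]) auto
      finally show ?thesis .
    qed
    then have "v \<bullet> (A *\<^sub>v v) = x \<bullet> (D *\<^sub>v x)" using move[of "D *\<^sub>v x"] D x by simp
    moreover have "(D *\<^sub>v x) $ i = e i * x $ i" if "i < n" for i
    proof -
      have "(D *\<^sub>v x) $ i = (\<Sum>j<n. D $$ (i, j) * x $ j)"
        using that D x by (auto simp: scalar_prod_def atLeast0LessThan intro!: sum.cong)
      also have "\<dots> = (\<Sum>j<n. if j = i then e i * x $ i else 0)"
        using offdiag that by (intro sum.cong) (auto simp: e_def)
      finally show ?thesis using that by simp
    qed
    then have "x \<bullet> (D *\<^sub>v x) = (\<Sum>i<n. e i * (\<Sum>j<n. u i j * c j)\<^sup>2)"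
      using D by (auto simp: scalar_prod_def atLeast0LessThan power2_eq_square xi intro!: sum.cong)
    ultimately show ?thesis by simp
  qed
  then show ?thesis using eig by blast
qed

text \<open>
  If fewer than \<open>card J\<close> eigenvalues were \<open>\<ge> b\<close>, some nonzero vector supported on \<open>J\<close> would be
  orthogonal to all their eigenvectors, and on it the form would be less than \<open>b\<close> times the squared
  norm.
\<close>

lemma courant_fischer_count:
  fixes A :: "real mat"
  assumes A: "A \<in> carrier_mat n n" and sym: "transpose_mat A = A" and J: "J \<subseteq> {..<n}"
    and form: "\<And>c. (\<And>j. j \<notin> J \<Longrightarrow> c j = 0) \<Longrightarrow>
      b * (\<Sum>j<n. (c j)\<^sup>2) \<le> (\<Sum>j<n. \<Sum>k<n. c j * c k * A $$ (j, k))"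
  shows "card J \<le> size (filter_mset (\<lambda>x. x \<ge> b) (eigenvalue_mset A))"
proof (rule ccontr)
  obtain e u where e: "eigenvalue_mset A = image_mset e (mset_set {..<n})"
    and quad: "\<And>c. (\<Sum>j<n. \<Sum>k<n. c j * c k * A $$ (j, k)) = (\<Sum>i<n. e i * (\<Sum>j<n. u i j * c j)\<^sup>2)"
    and nrm: "\<And>c. (\<Sum>j<n. (c j)\<^sup>2) = (\<Sum>i<n. (\<Sum>j<n. u i j * c j)\<^sup>2)"
    using symmetric_diagonal_form[OF A sym] by blast
  define K where "K = {i \<in> {..<n}. e i \<ge> b}"
  assume "\<not> ?thesis"
  moreover have "size (filter_mset (\<lambda>x. x \<ge> b) (eigenvalue_mset A)) = card K"
    by (simp add: e filter_mset_image_mset filter_mset_mset_set K_def)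
  ultimately have "card K < card J" by simp
  then obtain c where c: "\<exists>j\<in>J. c j \<noteq> 0" "\<And>j. j \<notin> J \<Longrightarrow> c j = 0" "\<And>i. i \<in> K \<Longrightarrow> (\<Sum>j\<in>J. u i j * c j) = 0"
    using homogeneous_system_nontrivial[of K J u] finite_subset[OF J] by (auto simp: K_def)
  define x where "x = (\<lambda>i. \<Sum>j<n. u i j * c j)"
  have xK: "x i = 0" if "i \<in> K" for i
  proof -
    have "x i = (\<Sum>j\<in>J. u i j * c j)"
      unfolding x_def by (rule sum.mono_neutral_right) (use J c(2) in auto)
    then show ?thesis using c(3)[OF that] by simp
  qed
  have "0 \<le> (\<Sum>i<n. (e i - b) * (x i)\<^sup>2)"
  proof -
    have "b * (\<Sum>i<n. (x i)\<^sup>2) \<le> (\<Sum>i<n. e i * (x i)\<^sup>2)"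
      using form[of c, OF c(2)] unfolding quad[of c] nrm[of c] x_def .
    then show ?thesis by (simp add: left_diff_distrib sum_subtractf sum_distrib_left)
  qed
  moreover have le: "(e i - b) * (x i)\<^sup>2 \<le> 0" if "i < n" for i
    using xK[of i] that by (cases "e i \<ge> b") (auto simp: K_def mult_nonpos_nonneg)
  moreover have "(\<Sum>i<n. (e i - b) * (x i)\<^sup>2) \<le> 0"
    by (rule sum_nonpos) (use le in simp)
  ultimately have "(\<Sum>i<n. (e i - b) * (x i)\<^sup>2) = 0" by simp
  then have "\<forall>i\<in>{..<n}. (e i - b) * (x i)\<^sup>2 = 0"
    using sum_nonneg_eq_0_iff[of "{..<n}" "\<lambda>i. - ((e i - b) * (x i)\<^sup>2)"] le by (simp add: sum_negf)
  then have "x i = 0" if "i < n" for i using xK[of i] that by (fastforce simp: K_def)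
  moreover have "(\<Sum>j<n. (c j)\<^sup>2) = (\<Sum>i<n. (x i)\<^sup>2)" unfolding nrm[of c] x_def ..
  ultimately have "(\<Sum>j<n. (c j)\<^sup>2) = 0" by simp
  then have "\<forall>j\<in>{..<n}. (c j)\<^sup>2 = 0" by (subst (asm) sum_nonneg_eq_0_iff) auto
  then show False using c(1) J by auto
qed

lemma size_eigenvalue_mset_symmetric:
  assumes "A \<in> carrier_mat n n" "transpose_mat A = A"
  shows "size (eigenvalue_mset A) = n"
  using symmetric_diagonal_form[OF assms] by auto

section \<open>Bernstein and Nikolskii inequalities for exponential sums\<close>

text \<open>
  Exponential sums with coefficients \<open>c\<close> and frequencies \<open>y\<close>. The frequencies are a function on the
  index set \<open>I\<close>, rather than the index set itself, so that they can be translated and may coincide.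
\<close>

definition exp_sum :: "('a \<Rightarrow> complex) \<Rightarrow> ('a \<Rightarrow> real) \<Rightarrow> 'a set \<Rightarrow> real \<Rightarrow> complex" where
  "exp_sum c y I w = (\<Sum>i\<in>I. c i * cis (w * y i))"

lemma exp_sum_has_vector_derivative:
  "(exp_sum c y I has_vector_derivative exp_sum (\<lambda>i. \<i> * y i * c i) y I w) (at w within S)"
proof -
  have "((\<lambda>w. cis (w * b)) has_vector_derivative (\<i> * b * cis (w * b))) (at w within S)" for b
  proof -
    have "((\<lambda>w. exp (\<i> * b * of_real w)) has_vector_derivative
        (exp (\<i> * b * of_real w) * (\<i> * b))) (at w within S)"
      by (rule has_vector_derivative_real_field) (auto intro!: derivative_eq_intros)
    then show ?thesis by (simp add: cis_conv_exp mult_ac)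
  qed
  then have "((\<lambda>w. \<Sum>i\<in>I. c i * cis (w * y i)) has_vector_derivative
      (\<Sum>i\<in>I. c i * (\<i> * y i * cis (w * y i)))) (at w within S)"
    by (intro has_vector_derivative_sum has_vector_derivative_mult_right)
  then show ?thesis by (simp add: exp_sum_def[abs_def] mult_ac)
qed

lemma continuous_on_exp_sum [continuous_intros]: "continuous_on S (exp_sum c y I)"
  by (auto simp: continuous_on_eq_continuous_within
      intro: has_vector_derivative_continuous exp_sum_has_vector_derivative)

text \<open>
  The argument \<open>H\<close> bounds the frequencies; it doubles in the recursion because removing one frequency
  by modulation shifts all the others.
\<close>

fun bernstein_const :: "nat \<Rightarrow> real \<Rightarrow> real" where
  "bernstein_const 0 H = 0"
| "bernstein_const (Suc n) H = 8 * (bernstein_const n (2 * H) + 1) + H"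

lemma bernstein_const_nonneg: "H \<ge> 0 \<Longrightarrow> bernstein_const n H \<ge> 0"
  by (induction n arbitrary: H) (auto intro!: add_nonneg_nonneg)

lemma norm_attains_max:
  assumes "continuous_on {-1..1::real} (f :: real \<Rightarrow> complex)"
  obtains x where "x \<in> {-1..1}" "\<And>w. w \<in> {-1..1} \<Longrightarrow> norm (f w) \<le> norm (f x)"
proof -
  have "\<exists>x\<in>{-1..1}. \<forall>w\<in>{-1..1}. norm (f w) \<le> norm (f x)"
    by (rule continuous_attains_sup) (use assms continuous_on_norm in auto)
  then show ?thesis using that by blast
qed

lemma deviation_from_value:
  fixes f f' :: "real \<Rightarrow> 'v::real_normed_vector"
  assumes f: "\<And>w. w \<in> {a..b} \<Longrightarrow> (f has_vector_derivative f' w) (at w within {a..b})"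
    and f': "\<And>w. w \<in> {a..b} \<Longrightarrow> norm (f' w) \<le> B"
    and "x \<in> {a..b}" "u \<in> {a..b}"
  shows "norm (f u - f x) \<le> B * \<bar>u - x\<bar>"
proof -
  have "norm (f u - f x) \<le> B * norm (u - x)"
  proof (rule differentiable_bound[where S = "{a..b}" and f' = "\<lambda>w h. h *\<^sub>R f' w"])
    show "onorm (\<lambda>h. h *\<^sub>R f' w) \<le> B" if "w \<in> {a..b}" for w
      using mult_left_mono[OF f'[OF that] abs_ge_zero] by (intro onorm_le) (simp add: mult.commute)
  qed (use assms in \<open>auto simp: has_vector_derivative_def\<close>)
  then show ?thesis by simp
qed

lemma first_order_remainder:
  fixes f g g' :: "real \<Rightarrow> 'v::real_normed_vector"
  assumes f: "\<And>w. w \<in> {a..b} \<Longrightarrow> (f has_vector_derivative g w) (at w within {a..b})"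
    and g: "\<And>w. w \<in> {a..b} \<Longrightarrow> (g has_vector_derivative g' w) (at w within {a..b})"
    and g': "\<And>w. w \<in> {a..b} \<Longrightarrow> norm (g' w) \<le> B"
    and x: "x \<in> {a..b}" and u: "u \<in> {a..b}"
  shows "norm (f u - f x - (u - x) *\<^sub>R g x) \<le> B * \<bar>u - x\<bar> ^ 2"
proof -
  define S where "S = {min u x..max u x}"
  have S: "S \<subseteq> {a..b}" using x u by (auto simp: S_def)
  define h where "h = (\<lambda>w. f w - w *\<^sub>R g x)"
  have B: "B \<ge> 0" using g'[OF x] norm_ge_zero order_trans by blast
  have "norm (h u - h x) \<le> (B * \<bar>u - x\<bar>) * norm (u - x)"
  proof (rule differentiable_bound[where S = S and f' = "\<lambda>w t. t *\<^sub>R (g w - g x)"])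
    show "(h has_derivative (\<lambda>t. t *\<^sub>R (g w - g x))) (at w within S)" if w: "w \<in> S" for w
    proof -
      have "(f has_vector_derivative g w) (at w within S)"
        using f w S has_vector_derivative_within_subset by blast
      then have "(h has_vector_derivative (g w - g x)) (at w within S)"
        unfolding h_def by (auto intro!: derivative_eq_intros)
      then show ?thesis by (simp add: has_vector_derivative_def)
    qed
    show "onorm (\<lambda>t. t *\<^sub>R (g w - g x)) \<le> B * \<bar>u - x\<bar>" if w: "w \<in> S" for w
    proof -
      have "norm (g w - g x) \<le> B * \<bar>w - x\<bar>"
        by (rule deviation_from_value[OF g g' x]) (use w S in auto)
      also have "\<dots> \<le> B * \<bar>u - x\<bar>" using w B by (intro mult_left_mono) (auto simp: S_def)
      finally have "norm (g w - g x) \<le> B * \<bar>u - x\<bar>" .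
      from mult_left_mono[OF this abs_ge_zero] show ?thesis
        by (intro onorm_le) (simp add: mult.commute)
    qed
  qed (auto simp: S_def)
  then show ?thesis by (simp add: h_def algebra_simps power2_eq_square)
qed

text \<open>
  Bernstein's inequality, by induction on the number of frequencies. After division by
  \<open>cis (w * y k)\<close> the frequency of the term \<open>k\<close> is zero, so the derivative \<open>v\<close> has one term fewer and
  the induction hypothesis bounds \<open>v'\<close> by \<open>K\<close> times the maximum \<open>V\<close> of \<open>|v|\<close>. Hence \<open>v\<close> stays close to its
  extreme value on an interval of length \<open>\<delta> = 1 / (2 (K + 1))\<close>, over which the sum changes by at
  least \<open>\<delta> V / 2\<close>. As it changes by at most \<open>2 S\<close>, it follows that \<open>V \<le> 4 S / \<delta> = 8 (K + 1) S\<close>. The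
  constant is uniform in the distances between the frequencies.
\<close>

lemma exp_sum_bernstein:
  assumes "finite I" "card I \<le> n" "\<And>i. i \<in> I \<Longrightarrow> \<bar>y i\<bar> \<le> H" "H \<ge> 0"
    and "\<And>w. w \<in> {-1..1} \<Longrightarrow> norm (exp_sum c y I w) \<le> S" and "w \<in> {-1..1}"
  shows "norm (exp_sum (\<lambda>i. \<i> * y i * c i) y I w) \<le> bernstein_const n H * S"
  using assms
proof (induction n arbitrary: I c y H S w)
  case 0
  then show ?case by (simp add: exp_sum_def)
next
  case (Suc n)
  have S0: "S \<ge> 0" using Suc.prems(5)[of 0] norm_ge_zero order_trans by (metis Suc.prems(5,6))
  show ?case
  proof (cases "I = {}")
    case True
    then show ?thesis using S0 bernstein_const_nonneg[OF Suc.prems(4), of "Suc n"]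
      by (simp add: exp_sum_def del: bernstein_const.simps)
  next
    case False
    then obtain k where k: "k \<in> I" by blast
    define J where "J = I - {k}"
    define z where "z = (\<lambda>i. y i - y k)"
    define d where "d = (\<lambda>i. \<i> * z i * c i)"
    have J: "finite J" "card J \<le> n" "\<And>i. i \<in> J \<Longrightarrow> \<bar>z i\<bar> \<le> 2 * H" "k \<notin> J" "I = insert k J"
      using Suc.prems(1-3) k abs_triangle_ineq4[of "y _" "y k"]
      by (auto simp: J_def z_def intro: order_trans[OF abs_triangle_ineq4])
         (smt (verit) Suc.prems(3))
    define K where "K = bernstein_const n (2 * H)"
    have K0: "K \<ge> 0" using Suc.prems(4) by (simp add: K_def bernstein_const_nonneg)
    have fact: "exp_sum c z I w = cis (- w * y k) * exp_sum c y I w" for w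
      by (simp add: exp_sum_def sum_distrib_left z_def cis_mult algebra_simps)
    have der: "(exp_sum c z I has_vector_derivative exp_sum d z J w) (at w within T)" for w T
    proof -
      have "exp_sum d z J w = exp_sum d z I w" using J by (simp add: exp_sum_def d_def z_def)
      then show ?thesis using exp_sum_has_vector_derivative[of c z I w T] by (simp add: d_def)
    qed
    obtain x where x: "x \<in> {-1..1}" "\<And>w. w \<in> {-1..1} \<Longrightarrow> norm (exp_sum d z J w) \<le> norm (exp_sum d z J x)"
      using norm_attains_max[OF continuous_on_exp_sum, of d z J] by blast
    define V where "V = norm (exp_sum d z J x)"
    define \<delta> where "\<delta> = 1 / (2 * (K + 1))"
    have \<delta>: "\<delta> > 0" "\<delta> \<le> 1" "K * \<delta> \<le> 1 / 2" using K0 by (auto simp: \<delta>_def field_simps)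
    \<comment> \<open>one of the points \<open>x \<plusminus> \<delta>\<close> lies in the interval, as \<open>\<delta> \<le> 1\<close>\<close>
    obtain u where u: "u \<in> {-1..1}" "\<bar>u - x\<bar> = \<delta>"
    proof (cases "x \<le> 0")
      case True
      then show ?thesis using that[of "x + \<delta>"] x \<delta> by auto
    next
      case False
      then show ?thesis using that[of "x - \<delta>"] x \<delta> by auto
    qed
    have "norm (exp_sum (\<lambda>i. \<i> * z i * d i) z J w) \<le> K * V" if "w \<in> {-1..1}" for w
      unfolding K_def V_def by (rule Suc.IH[OF J(1-3) _ x(2) that]) (use Suc.prems(4) in auto)
    then have rem: "norm (exp_sum c z I u - exp_sum c z I x - (u - x) *\<^sub>R exp_sum d z J x) \<le> K * V * \<bar>u - x\<bar> ^ 2"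
      using first_order_remainder[OF der exp_sum_has_vector_derivative _ x(1) u(1)] by blast
    have le: "norm (exp_sum c z I w) \<le> S" if "w \<in> {-1..1}" for w
      using Suc.prems(5)[OF that] by (simp add: fact norm_mult)
    have "\<delta> * V = norm ((u - x) *\<^sub>R exp_sum d z J x)" by (simp add: V_def u)
    also have "\<dots> \<le> norm (exp_sum c z I u) + norm (exp_sum c z I x) + K * V * \<delta> ^ 2"
      using rem unfolding u(2)
      by (smt (verit) norm_minus_commute norm_triangle_ineq2 norm_triangle_ineq4)
    also have "\<dots> \<le> 2 * S + (K * \<delta>) * (V * \<delta>)"
      using le[OF u(1)] le[OF x(1)] by (simp add: power2_eq_square mult_ac)
    also have "(K * \<delta>) * (V * \<delta>) \<le> 1 / 2 * (V * \<delta>)"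
      using \<delta> by (intro mult_right_mono) (auto simp: V_def)
    finally have "\<delta> * V \<le> 4 * S" by (simp add: mult.commute)
    then have V: "V \<le> 8 * (K + 1) * S" using K0 by (simp add: \<delta>_def field_simps)
    have "exp_sum (\<lambda>i. \<i> * y i * c i) y I w = cis (w * y k) * exp_sum d z J w + \<i> * y k * exp_sum c y I w"
    proof -
      have "exp_sum d z J w = exp_sum d z I w" using J by (simp add: exp_sum_def d_def z_def)
      then show ?thesis
        by (simp add: exp_sum_def sum_distrib_left sum.distrib[symmetric] d_def z_def cis_mult algebra_simps)
    qed
    then have "norm (exp_sum (\<lambda>i. \<i> * y i * c i) y I w) \<le> norm (exp_sum d z J w) + \<bar>y k\<bar> * norm (exp_sum c y I w)"
      by (metis (no_types, lifting) norm_triangle_ineq norm_mult norm_cis mult_1 norm_ii norm_of_real)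
    also have "\<dots> \<le> V + H * S"
      using x(2)[OF Suc.prems(6)] Suc.prems(3)[OF k] Suc.prems(5)[OF Suc.prems(6)] Suc.prems(4)
      by (intro add_mono mult_mono) (auto simp: V_def)
    also have "\<dots> \<le> bernstein_const (Suc n) H * S" using V by (simp add: K_def algebra_simps)
    finally show ?thesis .
  qed
qed

definition energy :: "(real \<Rightarrow> complex) \<Rightarrow> real" where
  "energy f = integral {-1..1} (\<lambda>w. (norm (f w))\<^sup>2)"

lemma energy_integrable:
  "continuous_on {a..b} f \<Longrightarrow> (\<lambda>w. (norm (f w))\<^sup>2) integrable_on {a..b::real}"
  by (intro integrable_continuous_interval continuous_intros) auto

text \<open>
  By Bernstein's inequality the sum keeps half of its maximal modulus on an interval of length
  \<open>1 / (2 (K + 1))\<close>, which by itself contributes enough energy.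
\<close>

lemma exp_sum_nikolskii:
  assumes "finite I" "card I \<le> n" "\<And>i. i \<in> I \<Longrightarrow> \<bar>y i\<bar> \<le> H" "H \<ge> 0" and w: "w \<in> {-1..1}"
  shows "(norm (exp_sum c y I w))\<^sup>2 \<le> 8 * (bernstein_const n H + 1) * energy (exp_sum c y I)"
proof -
  let ?p = "exp_sum c y I"
  define K where "K = bernstein_const n H"
  have K0: "K \<ge> 0" using assms(4) by (simp add: K_def bernstein_const_nonneg)
  obtain x where x: "x \<in> {-1..1}" "\<And>w. w \<in> {-1..1} \<Longrightarrow> norm (?p w) \<le> norm (?p x)"
    using norm_attains_max[OF continuous_on_exp_sum, of c y I] by blast
  define S where "S = norm (?p x)"
  have dev: "norm (?p u - ?p x) \<le> K * S * \<bar>u - x\<bar>" if "u \<in> {-1..1}" for u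
    using exp_sum_bernstein[OF assms(1-4) x(2)]
    by (intro deviation_from_value[OF exp_sum_has_vector_derivative _ x(1) that]) (auto simp: K_def S_def)
  define \<delta> where "\<delta> = 1 / (2 * (K + 1))"
  have \<delta>: "\<delta> > 0" "\<delta> \<le> 1" "K * \<delta> \<le> 1 / 2" using K0 by (auto simp: \<delta>_def field_simps)
  obtain a where a: "{a..a+\<delta>} \<subseteq> {-1..1}" "\<And>u. u \<in> {a..a+\<delta>} \<Longrightarrow> \<bar>u - x\<bar> \<le> \<delta>"
  proof (cases "x \<le> 0")
    case True
    then show ?thesis using that[of x] x \<delta> by auto
  next
    case False
    then show ?thesis using that[of "x - \<delta>"] x \<delta> by auto
  qed
  have low: "(S / 2)\<^sup>2 \<le> (norm (?p u))\<^sup>2" if u: "u \<in> {a..a+\<delta>}" for u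
  proof -
    have "norm (?p u - ?p x) \<le> K * S * \<bar>u - x\<bar>" using dev u a(1) by blast
    also have "\<dots> \<le> K * S * \<delta>" using a(2)[OF u] K0 by (intro mult_left_mono) (auto simp: S_def)
    also have "\<dots> = (K * \<delta>) * S" by simp
    also have "\<dots> \<le> 1 / 2 * S" using \<delta> by (intro mult_right_mono) (auto simp: S_def)
    finally have "S / 2 \<le> norm (?p u)"
      using norm_triangle_ineq2[of "?p x" "?p u"] by (simp add: S_def norm_minus_commute)
    then show ?thesis by (intro power_mono) (auto simp: S_def)
  qed
  have "\<delta> * (S / 2)\<^sup>2 = integral {a..a+\<delta>} (\<lambda>_. (S / 2)\<^sup>2)" using \<delta> by simp
  also have "\<dots> \<le> integral {a..a+\<delta>} (\<lambda>u. (norm (?p u))\<^sup>2)"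
    using low by (intro integral_le energy_integrable continuous_on_exp_sum) auto
  also have "\<dots> \<le> energy ?p" unfolding energy_def
    by (intro integral_subset_le a energy_integrable continuous_on_exp_sum) auto
  finally have "S\<^sup>2 \<le> 8 * (K + 1) * energy ?p" using K0 by (simp add: \<delta>_def field_simps)
  moreover have "(norm (?p w))\<^sup>2 \<le> S\<^sup>2" using x(2)[OF w] by (intro power_mono) (auto simp: S_def)
  ultimately show ?thesis by (simp add: K_def)
qed

section \<open>Almost orthogonality of separated clusters\<close>

text \<open>
  Integration by parts: the oscillating factor \<open>cis (w * D)\<close> is integrated and the slowly varying
  factor is differentiated, which gains \<open>1 / D\<close>.
\<close>

lemma cross_term_bound:
  fixes c :: "'a \<Rightarrow> complex" and d :: "'b \<Rightarrow> complex"
  assumes p: "\<And>w. w \<in> {-1..1} \<Longrightarrow> norm (exp_sum c y I w) \<le> P"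
    and p': "\<And>w. w \<in> {-1..1} \<Longrightarrow> norm (exp_sum (\<lambda>i. \<i> * y i * c i) y I w) \<le> K * P"
    and q: "\<And>w. w \<in> {-1..1} \<Longrightarrow> norm (exp_sum d z J w) \<le> Q"
    and q': "\<And>w. w \<in> {-1..1} \<Longrightarrow> norm (exp_sum (\<lambda>i. \<i> * z i * d i) z J w) \<le> K * Q"
    and D: "D \<noteq> 0"
  shows "norm (integral {-1..1} (\<lambda>w. cis (w * D) * (exp_sum c y I w * cnj (exp_sum d z J w))))
    \<le> (2 + 4 * K) * P * Q / \<bar>D\<bar>"
proof -
  let ?p = "exp_sum c y I" and ?q = "exp_sum d z J"
  let ?p' = "exp_sum (\<lambda>i. \<i> * y i * c i) y I" and ?q' = "exp_sum (\<lambda>i. \<i> * z i * d i) z J"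
  define F where "F = (\<lambda>w. cis (w * D) * (?p w * cnj (?q w)))"
  define R where "R = (\<lambda>w. cis (w * D) * (?p' w * cnj (?q w) + ?p w * cnj (?q' w)))"
  have cisD: "((\<lambda>w. cis (w * D)) has_vector_derivative \<i> * D * cis (w * D)) (at w within {-1..1})" for w
    using exp_sum_has_vector_derivative[of "\<lambda>_::unit. 1" "\<lambda>_. D" UNIV w "{-1..1}"]
    by (simp add: exp_sum_def[abs_def] UNIV_unit)
  have pos: "P \<ge> 0" "Q \<ge> 0" using p[of 0] q[of 0] norm_ge_zero order_trans by (metis atLeastAtMost_iff p q zero_le_one neg_le_0_iff_le)+
  have der: "(F has_vector_derivative (\<i> * D * F w + R w)) (at w within {-1..1})" for w
  proof -
    have "((\<lambda>w. cnj (?q w)) has_vector_derivative cnj (?q' w)) (at w within {-1..1})"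
      by (intro has_vector_derivative_cnj exp_sum_has_vector_derivative)
    then have "((\<lambda>w. ?p w * cnj (?q w)) has_vector_derivative (?p w * cnj (?q' w) + ?p' w * cnj (?q w)))
        (at w within {-1..1})"
      by (intro has_vector_derivative_mult exp_sum_has_vector_derivative)
    from has_vector_derivative_mult[OF cisD this] show ?thesis
      by (simp add: F_def R_def algebra_simps)
  qed
  have ccis: "continuous_on S (\<lambda>w. cis (w * D))" for S
    by (intro continuous_intros)
  have cF: "continuous_on {-1..1} F" and cR: "continuous_on {-1..1} R"
    unfolding F_def R_def by (intro continuous_intros ccis continuous_on_cnj)+
  note intF = integrable_continuous_interval[OF cF] and intR = integrable_continuous_interval[OF cR]
  have "((\<lambda>w. \<i> * D * F w + R w) has_integral (F 1 - F (-1))) {-1..1}"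
    by (rule fundamental_theorem_of_calculus) (use der in auto)
  then have "F 1 - F (-1) = integral {-1..1} (\<lambda>w. \<i> * D * F w + R w)"
    by (simp add: integral_unique)
  also have "\<dots> = \<i> * D * integral {-1..1} F + integral {-1..1} R"
    using intF intR by (subst integral_add) (auto intro!: integrable_on_mult_right)
  finally have "\<i> * D * integral {-1..1} F = F 1 - F (-1) - integral {-1..1} R" by simp
  then have "\<bar>D\<bar> * norm (integral {-1..1} F) = norm (F 1 - F (-1) - integral {-1..1} R)"
    by (metis mult_1 norm_ii norm_mult norm_of_real)
  also have "\<dots> \<le> norm (F 1) + norm (F (-1)) + norm (integral {-1..1} R)"
    by (smt (verit) norm_triangle_ineq4)
  also have "norm (integral {-1..1} R) \<le> (2 * K * P * Q) * (1 - (-1))"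
  proof (rule integral_bound[OF _ cR])
    fix w :: real assume w: "w \<in> {-1..1}"
    have "norm (R w) \<le> norm (?p' w) * norm (?q w) + norm (?p w) * norm (?q' w)"
      unfolding R_def by (metis (no_types, lifting) norm_triangle_ineq norm_mult norm_cis mult_1 complex_mod_cnj)
    also have "\<dots> \<le> (K * P) * Q + P * (K * Q)"
      using p[OF w] q[OF w] p'[OF w] q'[OF w] pos by (intro add_mono mult_mono) (auto intro: order_trans[OF norm_ge_zero])
    finally show "norm (R w) \<le> 2 * K * P * Q" by simp
  qed auto
  also have "norm (F 1) \<le> P * Q"
    unfolding F_def using p[of 1] q[of 1] pos by (simp add: norm_mult mult_mono)
  also have "norm (F (-1)) \<le> P * Q"
    unfolding F_def using p[of "-1"] q[of "-1"] pos by (simp add: norm_mult mult_mono)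
  finally have "\<bar>D\<bar> * norm (integral {-1..1} F) \<le> (2 + 4 * K) * P * Q" by (simp add: algebra_simps)
  then show ?thesis using D by (simp add: F_def field_simps)
qed

text \<open>
  The factor \<open>2 + 4 K\<close> of \<open>cross_term_bound\<close> times the factor \<open>8 (K + 1)\<close> of \<open>exp_sum_nikolskii\<close>.
\<close>

definition coupling_const :: "nat \<Rightarrow> real" where
  "coupling_const n = 16 * (1 + 2 * bernstein_const n 1) * (bernstein_const n 1 + 1)"

lemma coupling_const_pos: "coupling_const n > 0"
  using bernstein_const_nonneg[of 1 n] by (simp add: coupling_const_def)

lemma exp_sum_shift_frequency:
  fixes c :: "'a \<Rightarrow> complex" and y :: "'a \<Rightarrow> real" and a w :: real
  shows "exp_sum c y I w = cis (w * a) * exp_sum c (\<lambda>i. y i - a) I w"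
  by (simp add: exp_sum_def sum_distrib_left cis_mult algebra_simps)

lemma energy_nonneg: "continuous_on {-1..1} f \<Longrightarrow> energy f \<ge> 0"
  unfolding energy_def by (intro integral_nonneg energy_integrable) auto

text \<open>
  Modulation moves the two clusters to frequency \<open>0\<close> and leaves the oscillating factor
  \<open>cis (w * (a - b))\<close> in the inner product. The energies are not changed by it.
\<close>

lemma separated_clusters_almost_orthogonal:
  fixes c :: "'a \<Rightarrow> complex" and y :: "'a \<Rightarrow> real" and d :: "'b \<Rightarrow> complex" and z :: "'b \<Rightarrow> real"
  assumes I: "finite I" "card I \<le> n" "\<And>i. i \<in> I \<Longrightarrow> \<bar>y i - a\<bar> \<le> 1"
    and J: "finite J" "card J \<le> n" "\<And>i. i \<in> J \<Longrightarrow> \<bar>z i - b\<bar> \<le> 1"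
    and ab: "a \<noteq> b"
  shows "norm (integral {-1..1} (\<lambda>w. exp_sum c y I w * cnj (exp_sum d z J w)))
    \<le> coupling_const n / \<bar>a - b\<bar> * (sqrt (energy (exp_sum c y I)) * sqrt (energy (exp_sum d z J)))"
proof -
  define K where "K = bernstein_const n 1"
  have K0: "K \<ge> 0" by (simp add: K_def bernstein_const_nonneg)
  let ?p = "exp_sum c (\<lambda>i. y i - a) I" and ?q = "exp_sum d (\<lambda>i. z i - b) J"
  define P where "P = sqrt (8 * (K + 1)) * sqrt (energy ?p)"
  define Q where "Q = sqrt (8 * (K + 1)) * sqrt (energy ?q)"
  have e: "energy (exp_sum c y I) = energy ?p" "energy (exp_sum d z J) = energy ?q"
    unfolding energy_def exp_sum_shift_frequency[of c y I _ a] exp_sum_shift_frequency[of d z J _ b]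
    by (simp_all add: norm_mult)
  have nik: "norm (?p w) \<le> P" "norm (?q w) \<le> Q" if "w \<in> {-1..1}" for w
  proof -
    have "(norm (?p w))\<^sup>2 \<le> 8 * (K + 1) * energy ?p"
      unfolding K_def by (rule exp_sum_nikolskii) (use I that in auto)
    then show "norm (?p w) \<le> P" unfolding P_def real_sqrt_mult[symmetric] by (rule real_le_rsqrt)
    have "(norm (?q w))\<^sup>2 \<le> 8 * (K + 1) * energy ?q"
      unfolding K_def by (rule exp_sum_nikolskii) (use J that in auto)
    then show "norm (?q w) \<le> Q" unfolding Q_def real_sqrt_mult[symmetric] by (rule real_le_rsqrt)
  qed
  have "norm (integral {-1..1} (\<lambda>w. cis (w * (a - b)) * (?p w * cnj (?q w))))
    \<le> (2 + 4 * K) * P * Q / \<bar>a - b\<bar>"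
  proof (rule cross_term_bound)
    show "norm (exp_sum (\<lambda>i. \<i> * (y i - a) * c i) (\<lambda>i. y i - a) I w) \<le> K * P" if "w \<in> {-1..1}" for w
      unfolding K_def by (rule exp_sum_bernstein) (use I nik that in auto)
    show "norm (exp_sum (\<lambda>i. \<i> * (z i - b) * d i) (\<lambda>i. z i - b) J w) \<le> K * Q" if "w \<in> {-1..1}" for w
      unfolding K_def by (rule exp_sum_bernstein) (use J nik that in auto)
  qed (use nik ab in auto)
  also have "(2 + 4 * K) * P * Q / \<bar>a - b\<bar>
      = coupling_const n / \<bar>a - b\<bar> * (sqrt (energy ?p) * sqrt (energy ?q))"
  proof -
    have "(2 + 4 * K) * P * Q = (2 + 4 * K) * (sqrt (8 * (K + 1)))\<^sup>2 * (sqrt (energy ?p) * sqrt (energy ?q))"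
      by (simp add: P_def Q_def power2_eq_square mult_ac)
    also have "(2 + 4 * K) * (sqrt (8 * (K + 1)))\<^sup>2 = coupling_const n"
      using K0 by (simp add: coupling_const_def K_def[symmetric] algebra_simps)
    finally show ?thesis by simp
  qed
  also have "(\<lambda>w. cis (w * (a - b)) * (?p w * cnj (?q w))) = (\<lambda>w. exp_sum c y I w * cnj (exp_sum d z J w))"
  proof
    fix w
    have "cis (w * a) * cnj (cis (w * b)) = cis (w * (a - b))"
      by (simp add: cis_cnj cis_mult algebra_simps)
    then show "cis (w * (a - b)) * (?p w * cnj (?q w)) = exp_sum c y I w * cnj (exp_sum d z J w)"
      unfolding exp_sum_shift_frequency[of c y I w a] exp_sum_shift_frequency[of d z J w b]
      by (simp add: mult_ac)
  qed
  finally show ?thesis by (simp add: e)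
qed

lemma energy_sum:
  assumes "finite P" and cont: "\<And>C. C \<in> P \<Longrightarrow> continuous_on {-1..1} (f C)"
  shows "complex_of_real (energy (\<lambda>w. \<Sum>C\<in>P. f C w))
    = (\<Sum>C\<in>P. \<Sum>C'\<in>P. integral {-1..1} (\<lambda>w. f C w * cnj (f C' w)))"
proof -
  have int: "(\<lambda>w. f C w * cnj (f C' w)) integrable_on {-1..1}" if "C \<in> P" "C' \<in> P" for C C'
    by (intro integrable_continuous_interval continuous_intros continuous_on_cnj cont that)
  have "complex_of_real (energy (\<lambda>w. \<Sum>C\<in>P. f C w))
      = integral {-1..1} (\<lambda>w. complex_of_real ((norm (\<Sum>C\<in>P. f C w))\<^sup>2))"
    unfolding energy_def
    by (rule integral_unique[symmetric])
       (intro has_integral_of_real integrable_integral energy_integrable continuous_on_sum cont)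
  also have "\<dots> = integral {-1..1} (\<lambda>w. \<Sum>C\<in>P. \<Sum>C'\<in>P. f C w * cnj (f C' w))"
    by (intro arg_cong2[where f = integral] ext refl) (simp only: complex_norm_square cnj_sum sum_product)
  also have "\<dots> = (\<Sum>C\<in>P. \<Sum>C'\<in>P. integral {-1..1} (\<lambda>w. f C w * cnj (f C' w)))"
    using int assms(1) by (simp add: integral_sum integrable_sum)
  finally show ?thesis .
qed

text \<open>
  The Gram matrix of the cluster parts is diagonally dominant: with
  \<open>\<kappa> = coupling_const n / \<theta>\<close> and \<open>sqrt e * sqrt e' \<le> (e + e') / 2\<close> each off-diagonal entry costs at most
  \<open>\<kappa> / 2\<close> times the sum of the two energies, hence all of them together at most \<open>\<kappa> * card P \<le> 1 / 2\<close>
  times the sum of all energies.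
\<close>

lemma energy_separated_clusters:
  assumes P: "finite P" "real (card P) * coupling_const n * 2 \<le> \<theta>" "\<theta> > 0"
    and T: "\<And>C. C \<in> P \<Longrightarrow> finite (T C)" "\<And>C. C \<in> P \<Longrightarrow> card (T C) \<le> n"
      "\<And>C x. C \<in> P \<Longrightarrow> x \<in> T C \<Longrightarrow> \<bar>y x - a C\<bar> \<le> 1"
    and sep: "\<And>C C'. C \<in> P \<Longrightarrow> C' \<in> P \<Longrightarrow> C \<noteq> C' \<Longrightarrow> \<theta> \<le> \<bar>a C - a C'\<bar>"
  shows "energy (\<lambda>w. \<Sum>C\<in>P. exp_sum c y (T C) w) \<ge> 1 / 2 * (\<Sum>C\<in>P. energy (exp_sum c y (T C)))"
proof -
  let ?f = "\<lambda>C. exp_sum c y (T C)"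
  let ?e = "\<lambda>C. energy (?f C)"
  define G where "G = (\<lambda>C C'. integral {-1..1} (\<lambda>w. ?f C w * cnj (?f C' w)))"
  define \<kappa> where "\<kappa> = coupling_const n / \<theta>"
  have e0: "?e C \<ge> 0" for C by (intro energy_nonneg continuous_on_exp_sum)
  have GCC: "G C C = of_real (?e C)" for C
    using energy_sum[of "{C}" ?f] by (simp add: G_def continuous_on_exp_sum)
  have "complex_of_real (energy (\<lambda>w. \<Sum>C\<in>P. ?f C w)) = (\<Sum>C\<in>P. \<Sum>C'\<in>P. G C C')"
    unfolding G_def by (intro energy_sum P(1) continuous_on_exp_sum)
  then have "energy (\<lambda>w. \<Sum>C\<in>P. ?f C w) = Re (\<Sum>C\<in>P. \<Sum>C'\<in>P. G C C')" by (metis Re_complex_of_real)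
  also have "\<dots> = (\<Sum>C\<in>P. \<Sum>C'\<in>P. Re (G C C'))" by simp
  also have "\<dots> \<ge> (\<Sum>C\<in>P. \<Sum>C'\<in>P. (if C' = C then ?e C else 0) - \<kappa> / 2 * (?e C + ?e C'))"
  proof (intro sum_mono)
    fix C C' assume C: "C \<in> P" "C' \<in> P"
    have \<kappa>0: "\<kappa> \<ge> 0" using coupling_const_pos[of n] P(3) by (simp add: \<kappa>_def)
    show "(if C' = C then ?e C else 0) - \<kappa> / 2 * (?e C + ?e C') \<le> Re (G C C')"
    proof (cases "C' = C")
      case True
      then show ?thesis using e0[of C] \<kappa>0 by (simp add: GCC)
    next
      case False
      have "a C \<noteq> a C'" using sep[OF C] False P(3) by force
      then have "norm (G C C') \<le> coupling_const n / \<bar>a C - a C'\<bar> * (sqrt (?e C) * sqrt (?e C'))"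
        unfolding G_def using C T by (intro separated_clusters_almost_orthogonal) auto
      also have "\<dots> \<le> \<kappa> * ((?e C + ?e C') / 2)"
      proof (rule mult_mono)
        show "coupling_const n / \<bar>a C - a C'\<bar> \<le> \<kappa>" unfolding \<kappa>_def
          using sep[OF C] False P(3) coupling_const_pos[of n] by (intro divide_left_mono) auto
        show "sqrt (?e C) * sqrt (?e C') \<le> (?e C + ?e C') / 2"
          using arith_geo_mean_sqrt[OF e0[of C] e0[of C']] by (simp add: real_sqrt_mult)
      qed (use \<kappa>0 e0 in auto)
      finally show ?thesis using False complex_Re_le_cmod[of "- G C C'"] by simp
    qed
  qed
  also have "(\<Sum>C\<in>P. \<Sum>C'\<in>P. (if C' = C then ?e C else 0) - \<kappa> / 2 * (?e C + ?e C'))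
      = (1 - \<kappa> * card P) * (\<Sum>C\<in>P. ?e C)"
  proof -
    have "(\<Sum>C\<in>P. \<Sum>C'\<in>P. \<kappa> / 2 * (?e C + ?e C')) = \<kappa> / 2 * (2 * card P * (\<Sum>C\<in>P. ?e C))"
      unfolding sum_distrib_left[symmetric] sum.distrib by (simp add: sum_distrib_left[symmetric])
    then show ?thesis using P(1) by (simp add: sum_subtractf algebra_simps)
  qed
  also have "\<dots> \<ge> 1 / 2 * (\<Sum>C\<in>P. ?e C)"
  proof (rule mult_right_mono)
    show "1 / 2 \<le> 1 - \<kappa> * card P" using P(2,3) by (simp add: \<kappa>_def field_simps)
  qed (simp add: sum_nonneg e0)
  finally show ?thesis by simp
qed

section \<open>The energy of a single cluster\<close>

lemma exp_sum_difference:
  "exp_sum c y I (w + t) - cis (t * s) * exp_sum c y I w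
    = exp_sum (\<lambda>i. c i * (cis (t * y i) - cis (t * s))) y I w"
  by (simp add: exp_sum_def sum_distrib_left sum_subtractf[symmetric] cis_mult[symmetric] algebra_simps)

lemma norm_diff_sq_le: "(norm (a - b :: 'a::real_normed_vector))\<^sup>2 \<le> 2 * (norm a)\<^sup>2 + 2 * (norm b)\<^sup>2"
proof -
  have "(norm (a - b))\<^sup>2 \<le> (norm a + norm b)\<^sup>2" by (intro power_mono norm_triangle_ineq4) auto
  also have "\<dots> \<le> 2 * (norm a)\<^sup>2 + 2 * (norm b)\<^sup>2"
    using zero_le_power2[of "norm a - norm b"] by (simp add: power2_sum power2_diff)
  finally show ?thesis .
qed

text \<open>
  One factor \<open>cis (t * y i) - cis (t * s)\<close> arises from the difference operator
  \<open>g \<mapsto> g (w + t) - cis (t * s) * g w\<close>. It shortens the interval by \<open>t\<close> and multiplies the energy by at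
  most \<open>4\<close>.
\<close>

lemma annihilator_energy_bound:
  assumes "finite S" "t \<ge> 0"
  shows "integral {-1..1 - real (card S) * t}
      (\<lambda>w. (norm (exp_sum (\<lambda>i. c i * (\<Prod>s\<in>S. cis (t * y i) - cis (t * s))) y I w))\<^sup>2)
    \<le> 4 ^ card S * energy (exp_sum c y I)"
  using assms
proof (induction S rule: finite_induct)
  case empty
  then show ?case by (simp add: energy_def)
next
  case (insert s S)
  define d where "d = (\<lambda>i. c i * (\<Prod>s\<in>S. cis (t * y i) - cis (t * s)))"
  let ?g = "exp_sum d y I"
  define b where "b = 1 - real (card S) * t"
  let ?h = "\<lambda>w. (norm (?g w))\<^sup>2"
  have card: "real (card (insert s S)) = real (card S) + 1" using insert.hyps by simp
  have int: "?h integrable_on {u..v}" for u v by (intro energy_integrable continuous_on_exp_sum)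
  have cshift: "continuous_on T (\<lambda>w. ?g (w + t))" for T
    by (rule continuous_on_compose2[OF continuous_on_exp_sum[of UNIV]]) (auto intro!: continuous_intros)
  have int': "(\<lambda>w. ?h (w + t)) integrable_on {u..v}" for u v by (intro energy_integrable cshift)
  have IH: "integral {-1..b} ?h \<le> 4 ^ card S * energy (exp_sum c y I)"
    using insert by (simp add: b_def d_def)
  have eq: "exp_sum (\<lambda>i. c i * (\<Prod>s\<in>insert s S. cis (t * y i) - cis (t * s))) y I w
      = ?g (w + t) - cis (t * s) * ?g w" for w
    unfolding exp_sum_difference using insert.hyps by (simp add: d_def mult_ac)
  have len: "1 - real (card (insert s S)) * t = b - t" unfolding card by (simp add: b_def algebra_simps)
  have "integral {-1..b - t} (\<lambda>w. (norm (?g (w + t) - cis (t * s) * ?g w))\<^sup>2)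
      \<le> integral {-1..b - t} (\<lambda>w. 2 * ?h (w + t) + 2 * ?h w)"
  proof (rule integral_le)
    show "(\<lambda>w. (norm (?g (w + t) - cis (t * s) * ?g w))\<^sup>2) integrable_on {-1..b - t}"
      by (intro energy_integrable continuous_intros cshift)
    show "(norm (?g (w + t) - cis (t * s) * ?g w))\<^sup>2 \<le> 2 * ?h (w + t) + 2 * ?h w" for w
      using norm_diff_sq_le[of "?g (w + t)" "cis (t * s) * ?g w"] by (simp add: norm_mult)
  qed (intro integrable_add integrable_on_mult_right int int')
  also have "\<dots> = 2 * integral {-1..b - t} (\<lambda>w. ?h (w + t)) + 2 * integral {-1..b - t} ?h"
    using int int' by (subst integral_add) (auto intro!: integrable_on_mult_right)
  also have "integral {-1..b - t} (\<lambda>w. ?h (w + t)) = integral {-1 + t..b} ?h"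
    using integral_shift_real_ivl[of "-1 + t" t b ?h] by simp
  also have "\<dots> \<le> integral {-1..b} ?h"
    using insert.prems by (intro integral_subset_le int) auto
  also have "integral {-1..b - t} ?h \<le> integral {-1..b} ?h"
    using insert.prems by (intro integral_subset_le int) auto
  finally show ?case using IH insert.hyps unfolding eq len by simp
qed

text \<open>
  After rotation by \<open>-b\<close> the chord joins \<open>1\<close> to \<open>cis (a - b)\<close>, and it is at least as long as its
  vertical component \<open>\<bar>sin (a - b)\<bar>\<close>. The derivative \<open>cos\<close> of \<open>sin\<close> is at least \<open>1 / 2\<close> on \<open>[0, 1]\<close>.
\<close>

lemma norm_cis_diff_ge:
  assumes "\<bar>a - b\<bar> \<le> 1"
  shows "norm (cis a - cis b) \<ge> \<bar>a - b\<bar> / 2"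
proof -
  have half: "sin u \<ge> u / 2" if u: "0 \<le> u" "u \<le> 1" for u :: real
  proof -
    have "(\<lambda>x. sin x - x / 2) 0 \<le> (\<lambda>x. sin x - x / 2) u"
    proof (rule DERIV_nonneg_imp_nondecreasing[OF u(1)])
      fix x :: real assume x: "0 \<le> x" "x \<le> u"
      have "pi / 3 \<ge> 1" using pi_gt3 by simp
      then have "cos x \<ge> cos (pi / 3)" using x u pi_gt_zero by (intro cos_monotone_0_pi_le) auto
      then show "\<exists>y. ((\<lambda>x. sin x - x / 2) has_real_derivative y) (at x) \<and> 0 \<le> y"
        by (intro exI[of _ "cos x - 1 / 2"]) (auto intro!: derivative_eq_intros simp: cos_60)
    qed
    then show ?thesis by simp
  qed
  have "cis a - cis b = cis b * (cis (a - b) - 1)" by (simp add: right_diff_distrib cis_mult)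
  then have "norm (cis a - cis b) = norm (cis (a - b) - 1)" by (simp add: norm_mult)
  also have "\<dots> \<ge> \<bar>Im (cis (a - b) - 1)\<bar>" by (rule abs_Im_le_cmod)
  also have "\<bar>Im (cis (a - b) - 1)\<bar> = \<bar>sin (a - b)\<bar>" by simp
  also have "\<dots> \<ge> \<bar>a - b\<bar> / 2"
    using half[of "a - b"] half[of "b - a"] assms sin_minus[of "b - a"] by (cases "a \<ge> b") auto
  finally show ?thesis by simp
qed

text \<open>
  The \<open>k\<close>-th point to the right of \<open>x\<close> has distance at least \<open>k \<Delta>\<close>. The second conjunct states this
  for the next point and makes the induction over the maximum of \<open>S\<close> work.
\<close>

lemma one_sided_separated_product:
  fixes x \<Delta> :: real
  assumes "finite S" "\<Delta> > 0" "\<And>s. s \<in> S \<Longrightarrow> x + \<Delta> \<le> s"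
    and "\<And>s s'. s \<in> S \<Longrightarrow> s' \<in> S \<Longrightarrow> s < s' \<Longrightarrow> s + \<Delta> \<le> s'"
  shows "fact (card S) * \<Delta> ^ card S \<le> (\<Prod>s\<in>S. s - x) \<and>
    (\<forall>b. (\<forall>s\<in>insert x S. s + \<Delta> \<le> b) \<longrightarrow> x + (real (card S) + 1) * \<Delta> \<le> b)"
  using assms
proof (induction S rule: finite_linorder_max_induct)
  case empty
  then show ?case by simp
next
  case (insert m S)
  have mS: "m \<notin> S" using insert.hyps by auto
  have IH: "fact (card S) * \<Delta> ^ card S \<le> (\<Prod>s\<in>S. s - x)"
    "\<And>b. (\<forall>s\<in>insert x S. s + \<Delta> \<le> b) \<Longrightarrow> x + (real (card S) + 1) * \<Delta> \<le> b"
    using insert.IH insert.prems by auto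
  have m: "x + (real (card S) + 1) * \<Delta> \<le> m"
    by (rule IH(2)) (use insert in auto)
  have "fact (card (insert m S)) * \<Delta> ^ card (insert m S) =
      ((real (card S) + 1) * \<Delta>) * (fact (card S) * \<Delta> ^ card S)"
    using mS insert.hyps by (simp add: algebra_simps)
  also have "\<dots> \<le> (m - x) * (\<Prod>s\<in>S. s - x)"
    using m IH(1) insert.prems(1) insert.prems(2)[of m] by (intro mult_mono) auto
  finally have "fact (card (insert m S)) * \<Delta> ^ card (insert m S) \<le> (\<Prod>s\<in>insert m S. s - x)"
    using mS insert.hyps by simp
  moreover have "x + (real (card (insert m S)) + 1) * \<Delta> \<le> b" if "\<forall>s\<in>insert x (insert m S). s + \<Delta> \<le> b" for b
    using m that mS insert.hyps by (auto simp: algebra_simps)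
  ultimately show ?case by blast
qed

text \<open>
  With \<open>r\<close> points to the right of \<open>x\<close> and \<open>k\<close> points to the left the product is at least
  \<open>r! k! \<Delta>\<^bsup>r+k\<^esup>\<close>, and \<open>(r + k)! \<le> 2\<^bsup>r+k\<^esup> r! k!\<close>.
\<close>

lemma separated_product:
  fixes x \<Delta> :: real
  assumes S: "finite S" and \<Delta>: "\<Delta> > 0" and sep: "\<And>s. s \<in> S \<Longrightarrow> \<Delta> \<le> \<bar>x - s\<bar>"
    "\<And>s s'. s \<in> S \<Longrightarrow> s' \<in> S \<Longrightarrow> s \<noteq> s' \<Longrightarrow> \<Delta> \<le> \<bar>s - s'\<bar>"
  shows "fact (card S) * (\<Delta> / 2) ^ card S \<le> (\<Prod>s\<in>S. \<bar>x - s\<bar>)"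
proof -
  define R L where "R = {s \<in> S. s > x}" and "L = {s \<in> S. s < x}"
  have fin: "finite R" "finite L" using S by (auto simp: R_def L_def)
  have "x \<notin> S" using sep(1)[of x] \<Delta> by auto
  then have SRL: "S = R \<union> L" "R \<inter> L = {}" by (auto simp: R_def L_def) (metis linorder_neqE_linordered_idom)
  have "fact (card R) * \<Delta> ^ card R \<le> (\<Prod>s\<in>R. s - x)"
    using one_sided_separated_product[OF fin(1) \<Delta>, of x] sep by (force simp: R_def)
  also have "\<dots> = (\<Prod>s\<in>R. \<bar>x - s\<bar>)" by (intro prod.cong) (auto simp: R_def)
  finally have 1: "fact (card R) * \<Delta> ^ card R \<le> (\<Prod>s\<in>R. \<bar>x - s\<bar>)" .
  have "fact (card (uminus ` L)) * \<Delta> ^ card (uminus ` L) \<le> (\<Prod>s\<in>uminus ` L. s - (- x))"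
    using one_sided_separated_product[of "uminus ` L" \<Delta> "- x"] fin \<Delta> sep by (force simp: L_def)
  then have "fact (card L) * \<Delta> ^ card L \<le> (\<Prod>s\<in>L. x - s)"
    by (simp add: card_image prod.reindex)
  also have "\<dots> = (\<Prod>s\<in>L. \<bar>x - s\<bar>)" by (intro prod.cong) (auto simp: L_def)
  finally have 2: "fact (card L) * \<Delta> ^ card L \<le> (\<Prod>s\<in>L. \<bar>x - s\<bar>)" .
  have cS: "card S = card R + card L" unfolding SRL(1) by (rule card_Un_disjoint[OF fin SRL(2)])
  have "fact (card R) * fact (card L) * (card S choose card R) = fact (card S)"
    using binomial_fact_lemma[of "card R" "card S"] by (simp add: cS)
  from arg_cong[OF this, of real]
  have "(fact (card S) :: real) = fact (card R) * fact (card L) * real (card S choose card R)" by simp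
  also have "\<dots> \<le> fact (card R) * fact (card L) * 2 ^ card S"
  proof (rule mult_left_mono)
    have "real (card S choose card R) \<le> real (2 ^ card S)"
      using binomial_le_pow2[of "card S" "card R"] by (simp only: of_nat_le_iff)
    then show "real (card S choose card R) \<le> 2 ^ card S" by simp
  qed simp
  finally have "fact (card S) * (\<Delta> / 2) ^ card S \<le> fact (card R) * fact (card L) * 2 ^ card S * (\<Delta> / 2) ^ card S"
    using \<Delta> by (intro mult_right_mono) auto
  also have "\<dots> = (fact (card R) * \<Delta> ^ card R) * (fact (card L) * \<Delta> ^ card L)"
    by (simp add: power_divide cS power_add)
  also have "\<dots> \<le> (\<Prod>s\<in>R. \<bar>x - s\<bar>) * (\<Prod>s\<in>L. \<bar>x - s\<bar>)"
    using 1 2 \<Delta> by (intro mult_mono prod_nonneg) auto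
  also have "\<dots> = (\<Prod>s\<in>S. \<bar>x - s\<bar>)" unfolding SRL(1) using fin SRL(2) by (simp add: prod.union_disjoint)
  finally show ?thesis .
qed

text \<open>
  The \<open>n\<close>-th term of the exponential series of \<open>n\<close> is at most its sum.
\<close>

lemma power_self_le_exp_fact: "real n ^ n \<le> exp 1 ^ n * fact n"
proof -
  have "(\<lambda>k. real n ^ k /\<^sub>R fact k) sums exp (real n)" by (rule exp_converges)
  then have "real n ^ n /\<^sub>R fact n \<le> exp (real n)"
    using sum_le_suminf[of "\<lambda>k. real n ^ k /\<^sub>R fact k" "{n}"] by (auto simp: sums_iff)
  moreover have "exp (real n) = exp 1 ^ n" by (simp add: exp_of_nat_mult[symmetric])
  ultimately show ?thesis by (simp add: field_simps)
qed

text \<open>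
  The difference operators for the nodes other than \<open>x\<close> isolate \<open>c x\<close> and give
  \<open>|c x|\<^sup>2 (\<Delta> / 4e)\<^bsup>2N\<^esup> \<le> 4\<^sup>N E\<close>. Summation over the \<open>N + 1 \<le> 2\<^sup>N\<close> nodes turns \<open>4\<^sup>N\<close> into \<open>8\<^sup>N\<close>, and
  \<open>8 \<le> (4 \<pi>)\<^sup>2\<close> absorbs this factor in the passage from \<open>4e\<close> to \<open>16 \<pi> e\<close>.
\<close>

lemma single_cluster_energy:
  fixes Y :: "real set" and c :: "real \<Rightarrow> complex"
  assumes Y: "finite Y" "Y \<noteq> {}" and \<Delta>: "\<Delta> > 0"
    and sep: "\<And>x y. x \<in> Y \<Longrightarrow> y \<in> Y \<Longrightarrow> x \<noteq> y \<Longrightarrow> \<Delta> \<le> \<bar>x - y\<bar> \<and> \<bar>x - y\<bar> \<le> 1"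
  shows "(\<Delta> / (16 * pi * exp 1)) ^ (2 * (card Y - 1)) * (\<Sum>x\<in>Y. (norm (c x))\<^sup>2)
    \<le> energy (exp_sum c (\<lambda>x. x) Y)"
proof -
  define N where "N = card Y - 1"
  \<comment> \<open>for \<open>N = 0\<close> division by zero gives \<open>t = 0\<close>, and \<open>N * t \<le> 1\<close> holds in that case as well\<close>
  define t where "t = 1 / real N"
  let ?E = "energy (exp_sum c (\<lambda>x. x) Y)"
  have cardY: "card Y = Suc N" using Y by (simp add: N_def card_gt_0_iff)
  have E0: "?E \<ge> 0" by (intro energy_nonneg continuous_on_exp_sum)
  have coeff: "(norm (c x))\<^sup>2 * (\<Delta> / (4 * exp 1)) ^ (2 * N) \<le> 4 ^ N * ?E" if x: "x \<in> Y" for x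
  proof -
    define S where "S = Y - {x}"
    have S: "finite S" "card S = N" using Y x by (auto simp: S_def N_def)
    have t: "t \<ge> 0" "real N * t \<le> 1" by (auto simp: t_def)
    define X where "X = (\<Prod>s\<in>S. cis (t * x) - cis (t * s))"
    have "(\<Delta> / (4 * exp 1)) ^ N \<le> norm X"
    proof (cases "N = 0")
      case True
      then show ?thesis using S by (simp add: X_def)
    next
      case False
      then have N: "N \<ge> 1" by simp
      have "(\<Delta> / (4 * exp 1)) ^ N = (1 / exp 1 ^ N) * (\<Delta> / 4) ^ N"
        by (simp add: power_divide power_mult_distrib)
      also have "\<dots> \<le> (fact N / real N ^ N) * (\<Delta> / 4) ^ N"
        using power_self_le_exp_fact[of N] N \<Delta> by (intro mult_right_mono) (auto simp: field_simps)
      also have "\<dots> = (t / 2) ^ N * (fact (card S) * (\<Delta> / 2) ^ card S)"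
      proof -
        have "(t / 2) ^ N * (\<Delta> / 2) ^ N = ((t / 2) * (\<Delta> / 2)) ^ N" by (simp only: power_mult_distrib)
        also have "(t / 2) * (\<Delta> / 2) = (\<Delta> / 4) / real N" by (simp add: t_def)
        also have "\<dots> ^ N = (\<Delta> / 4) ^ N / real N ^ N" by (simp only: power_divide)
        finally have "fact N * ((t / 2) ^ N * (\<Delta> / 2) ^ N) = fact N * ((\<Delta> / 4) ^ N / real N ^ N)"
          by (rule arg_cong)
        then show ?thesis by (simp add: S(2) mult.left_commute)
      qed
      also have "\<dots> \<le> (t / 2) ^ N * (\<Prod>s\<in>S. \<bar>x - s\<bar>)"
        using sep x S t \<Delta> by (intro mult_left_mono separated_product) (auto simp: S_def)
      also have "\<dots> = (\<Prod>s\<in>S. \<bar>t * x - t * s\<bar> / 2)"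
      proof -
        have "\<bar>t * x - t * s\<bar> / 2 = (t / 2) * \<bar>x - s\<bar>" for s
          using t(1) by (simp add: right_diff_distrib[symmetric] abs_mult)
        then show ?thesis by (simp only: prod.distrib prod_constant S(2))
      qed
      also have "\<dots> \<le> (\<Prod>s\<in>S. norm (cis (t * x) - cis (t * s)))"
      proof (intro prod_mono conjI norm_cis_diff_ge)
        fix s assume "s \<in> S"
        then have "\<bar>x - s\<bar> \<le> 1" using sep[of x s] x by (auto simp: S_def)
        moreover have "t \<le> 1" using N by (simp add: t_def)
        ultimately show "\<bar>t * x - t * s\<bar> \<le> 1"
          using t by (simp add: right_diff_distrib[symmetric] abs_mult mult_le_one)
      qed auto
      finally show ?thesis by (simp add: X_def prod_norm)
    qed
    then have "((\<Delta> / (4 * exp 1)) ^ N)\<^sup>2 \<le> (norm X)\<^sup>2" using \<Delta> by (intro power_mono) auto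
    then have "(norm (c x))\<^sup>2 * (\<Delta> / (4 * exp 1)) ^ (2 * N) \<le> (norm (c x * X))\<^sup>2"
      by (simp add: norm_mult power_mult_distrib power_mult mult.commute[of 2] mult_left_mono)
    also have "\<dots> \<le> (2 - real N * t) * (norm (c x * X))\<^sup>2"
      using t(2) mult_right_mono[of 1 "2 - real N * t" "(norm (c x * X))\<^sup>2"] by simp
    also have "\<dots> = integral {-1..1 - real N * t} (\<lambda>w. (norm (c x * X))\<^sup>2)"
      using t by simp
    also have "\<dots> = integral {-1..1 - real (card S) * t}
        (\<lambda>w. (norm (exp_sum (\<lambda>z. c z * (\<Prod>s\<in>S. cis (t * z) - cis (t * s))) (\<lambda>z. z) Y w))\<^sup>2)"
    proof -
      have "exp_sum (\<lambda>z. c z * (\<Prod>s\<in>S. cis (t * z) - cis (t * s))) (\<lambda>z. z) Y w = c x * X * cis (w * x)" for w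
      proof -
        have "(\<Prod>s\<in>S. cis (t * z) - cis (t * s)) = 0" if "z \<in> Y - {x}" for z
          using that S(1) by (intro prod_zero) (auto simp: S_def)
        then have "exp_sum (\<lambda>z. c z * (\<Prod>s\<in>S. cis (t * z) - cis (t * s))) (\<lambda>z. z) Y w
            = (\<Sum>z\<in>{x}. c z * (\<Prod>s\<in>S. cis (t * z) - cis (t * s)) * cis (w * z))"
          unfolding exp_sum_def using Y x by (intro sum.mono_neutral_right) auto
        then show ?thesis by (simp add: X_def)
      qed
      then show ?thesis by (simp add: S(2) norm_mult)
    qed
    also have "\<dots> \<le> 4 ^ card S * ?E" by (rule annihilator_energy_bound[OF S(1) t(1)])
    finally show ?thesis by (simp add: S(2))
  qed
  have "(\<Sum>x\<in>Y. (norm (c x))\<^sup>2) * (\<Delta> / (4 * exp 1)) ^ (2 * N) \<le> (\<Sum>x\<in>Y. 4 ^ N * ?E)"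
    unfolding sum_distrib_right by (intro sum_mono coeff)
  also have "\<dots> = real (Suc N) * 4 ^ N * ?E" by (simp add: cardY)
  also have "\<dots> \<le> 2 ^ N * 4 ^ N * ?E"
  proof -
    have "Suc N \<le> 2 ^ N" using less_exp[of N] by (simp only: Suc_le_eq)
    then have "real (Suc N) \<le> 2 ^ N" by (metis of_nat_le_iff of_nat_numeral of_nat_power)
    then show ?thesis using E0 by (intro mult_right_mono) auto
  qed
  also have "(2::real) ^ N * 4 ^ N = (2 * 4) ^ N" by (simp only: power_mult_distrib)
  finally have main: "(\<Sum>x\<in>Y. (norm (c x))\<^sup>2) * (\<Delta> / (4 * exp 1)) ^ (2 * N) \<le> 8 ^ N * ?E" by simp
  have "(\<Delta> / (16 * pi * exp 1)) ^ (2 * N) \<le> ((\<Delta> / (4 * exp 1)) ^ (2 * N)) / 8 ^ N"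
  proof -
    have "8 * (\<Delta> / (16 * pi * exp 1))\<^sup>2 \<le> (\<Delta> / (4 * exp 1))\<^sup>2"
    proof -
      have "(\<Delta> / (4 * exp 1))\<^sup>2 = (4 * pi)\<^sup>2 * (\<Delta> / (16 * pi * exp 1))\<^sup>2"
        by (simp add: power2_eq_square field_simps)
      moreover have "8 \<le> (4 * pi)\<^sup>2"
        using pi_gt3 power_mono[of 12 "4 * pi" 2] by simp
      ultimately show ?thesis by (simp add: mult_right_mono)
    qed
    moreover have "r ^ (2 * N) \<le> u ^ (2 * N) / 8 ^ N" if "8 * r\<^sup>2 \<le> u\<^sup>2" for r u :: real
    proof -
      have "(8 * r\<^sup>2) ^ N \<le> (u\<^sup>2) ^ N" using that by (intro power_mono) auto
      then have "8 ^ N * r ^ (2 * N) \<le> u ^ (2 * N)" by (simp only: power_mult_distrib power_mult)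
      then show ?thesis by (simp add: pos_le_divide_eq mult.commute)
    qed
    ultimately show ?thesis by blast
  qed
  then have "(\<Delta> / (16 * pi * exp 1)) ^ (2 * N) * (\<Sum>x\<in>Y. (norm (c x))\<^sup>2)
      \<le> ((\<Delta> / (4 * exp 1)) ^ (2 * N)) / 8 ^ N * (\<Sum>x\<in>Y. (norm (c x))\<^sup>2)"
    by (intro mult_right_mono sum_nonneg) auto
  also have "\<dots> \<le> ?E" using main by (simp add: field_simps)
  finally show ?thesis by (simp add: N_def)
qed

section \<open>The prolate matrix\<close>

text \<open>
  Double counting of the pairs \<open>(C, k)\<close> with \<open>1 \<le> k \<le> min m (card C)\<close>.
\<close>

lemma sum_num_clusters_ge:
  assumes "finite P"
  shows "(\<Sum>k=1..m. num_clusters_ge P k) = (\<Sum>C\<in>P. min m (card C))"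
proof -
  have "(\<Sum>k=1..m. num_clusters_ge P k) = (\<Sum>k=1..m. \<Sum>C\<in>P. if k \<le> card C then 1 else 0)"
    unfolding num_clusters_ge_def using assms by (simp add: sum.If_cases Int_def)
  also have "\<dots> = (\<Sum>C\<in>P. \<Sum>k=1..m. if k \<le> card C then 1 else 0)" by (rule sum.swap)
  also have "\<dots> = (\<Sum>C\<in>P. min m (card C))"
  proof (rule sum.cong[OF refl])
    fix C :: "real set"
    have "{1..m} \<inter> {k. k \<le> card C} = {1..min m (card C)}" by auto
    then show "(\<Sum>k=1..m. if k \<le> card C then 1 else 0) = min m (card C)" by (simp add: sum.If_cases)
  qed
  finally show ?thesis .
qed

text \<open>
  Exchanging the two nodes conjugates the integrand.
\<close>

lemma prolate_mat_symmetric: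
  "prolate_mat xs \<in> carrier_mat (length xs) (length xs)"
  "transpose_mat (prolate_mat xs) = prolate_mat xs"
proof -
  show "prolate_mat xs \<in> carrier_mat (length xs) (length xs)" by (simp add: prolate_mat_def)
  have "Re (integral {-1..1} (\<lambda>w::real. exp (\<i> * complex_of_real (w * (x - y)))))
      = Re (integral {-1..1} (\<lambda>w::real. exp (\<i> * complex_of_real (w * (y - x)))))" for x y :: real
  proof -
    have "cnj (integral {-1..1} (\<lambda>w::real. exp (\<i> * complex_of_real (w * (x - y)))))
      = integral {-1..1} (\<lambda>w::real. exp (\<i> * complex_of_real (w * (y - x))))"
      unfolding integral_cnj
      by (intro arg_cong2[where f = integral] refl ext) (simp add: exp_cnj right_diff_distrib algebra_simps)
    from arg_cong[OF this, of Re] show ?thesis by (simp only: cnj.sel(1))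
  qed
  then show "transpose_mat (prolate_mat xs) = prolate_mat xs"
    by (intro eq_matI) (auto simp: prolate_mat_def)
qed

lemma prolate_mat_quadratic_form:
  "(\<Sum>j<length xs. \<Sum>k<length xs. c j * c k * prolate_mat xs $$ (j, k))
    = 1 / 2 * energy (exp_sum (\<lambda>j. complex_of_real (c j)) ((!) xs) {..<length xs})"
proof -
  let ?n = "length xs"
  let ?f = "\<lambda>j w. complex_of_real (c j) * cis (w * xs ! j)"
  have cont: "continuous_on {-1..1} (?f j)" for j by (intro continuous_intros)
  have "complex_of_real (energy (exp_sum (\<lambda>j. complex_of_real (c j)) ((!) xs) {..<?n}))
      = (\<Sum>j<?n. \<Sum>k<?n. integral {-1..1} (\<lambda>w. ?f j w * cnj (?f k w)))"
    unfolding exp_sum_def[abs_def] by (intro energy_sum cont) auto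
  from arg_cong[OF this, of Re]
  have "energy (exp_sum (\<lambda>j. complex_of_real (c j)) ((!) xs) {..<?n})
      = (\<Sum>j<?n. \<Sum>k<?n. Re (integral {-1..1} (\<lambda>w. ?f j w * cnj (?f k w))))"
    by (simp only: Re_sum Re_complex_of_real)
  also have "\<dots> = (\<Sum>j<?n. \<Sum>k<?n. 2 * (c j * c k * prolate_mat xs $$ (j, k)))"
  proof (intro sum.cong refl)
    fix j k assume jk: "j \<in> {..<?n}" "k \<in> {..<?n}"
    have "?f j w * cnj (?f k w) = of_real (c j * c k) * exp (\<i> * complex_of_real (w * (xs ! j - xs ! k)))" for w
    proof -
      have "cis (w * xs ! j) * cnj (cis (w * xs ! k)) = cis (w * (xs ! j - xs ! k))"
        by (simp add: cis_cnj cis_mult right_diff_distrib)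
      then show ?thesis unfolding cis_conv_exp[symmetric] by (simp add: mult_ac)
    qed
    then have "(\<lambda>w. ?f j w * cnj (?f k w))
        = (\<lambda>w. of_real (c j * c k) * exp (\<i> * complex_of_real (w * (xs ! j - xs ! k))))" by (rule ext)
    then show "Re (integral {-1..1} (\<lambda>w. ?f j w * cnj (?f k w))) = 2 * (c j * c k * prolate_mat xs $$ (j, k))"
      using jk by (simp only:) (simp add: prolate_mat_def)
  qed
  also have "\<dots> = 2 * (\<Sum>j<?n. \<Sum>k<?n. c j * c k * prolate_mat xs $$ (j, k))"
    by (simp only: sum_distrib_left)
  finally show ?thesis by simp
qed

text \<open>
  Two losses of a factor \<open>1 / 2\<close> make up the constant \<open>1 / 4\<close>: the interaction between the clusters and
  the normalization of the integral in the matrix. A kept part \<open>T C\<close> with fewer than \<open>m\<close> nodes obeys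
  the bound for \<open>m\<close> because \<open>\<Delta> / (16 * pi * exp 1) \<le> 1\<close>; for \<open>m = 1\<close> the exponent is \<open>0\<close> anyway.
\<close>

lemma clustered_form_lower_bound:
  fixes c :: "nat \<Rightarrow> real"
  assumes xs: "distinct xs" and P: "partition_on (set xs) P" and \<Delta>: "\<Delta> > 0"
    and near: "\<And>C x y. C \<in> P \<Longrightarrow> x \<in> C \<Longrightarrow> y \<in> C \<Longrightarrow> x \<noteq> y \<Longrightarrow> \<Delta> \<le> \<bar>x - y\<bar> \<and> \<bar>x - y\<bar> \<le> 1"
    and far: "\<And>C x y. C \<in> P \<Longrightarrow> x \<in> C \<Longrightarrow> y \<in> set xs - C \<Longrightarrow> \<theta> \<le> \<bar>x - y\<bar>"
    and \<theta>: "\<theta> > 0" "2 * coupling_const l * real (length xs) \<le> \<theta>"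
    and T: "\<And>C. C \<in> P \<Longrightarrow> T C \<subseteq> C \<and> T C \<noteq> {} \<and> card (T C) \<le> m" and ml: "m \<le> l"
    and small: "m = 1 \<or> \<Delta> \<le> 1"
    and supp: "\<And>j. j < length xs \<Longrightarrow> xs ! j \<notin> (\<Union>C\<in>P. T C) \<Longrightarrow> c j = 0"
  shows "1 / 4 * (\<Delta> / (16 * pi * exp 1)) ^ (2 * (m - 1)) * (\<Sum>j<length xs. (c j)\<^sup>2)
    \<le> (\<Sum>j<length xs. \<Sum>k<length xs. c j * c k * prolate_mat xs $$ (j, k))"
proof -
  let ?n = "length xs" and ?r = "\<Delta> / (16 * pi * exp 1)"
  define g where "g = (\<lambda>x. complex_of_real (c (the_inv_into {..<?n} ((!) xs) x)))"
  have bij: "bij_betw ((!) xs) {..<?n} (set xs)" using xs by (rule bij_betw_nth) auto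
  have g: "g (xs ! j) = c j" if "j < ?n" for j
    using bij that by (simp add: g_def the_inv_into_f_f bij_betw_def)
  have finP: "finite P" using P by (rule finite_elements[rotated]) simp
  have sub: "C \<subseteq> set xs" if "C \<in> P" for C using P that by (auto simp: partition_on_def)
  have finC: "finite C" if "C \<in> P" for C using sub[OF that] finite_subset by blast
  have finT: "finite (T C)" if "C \<in> P" for C using T[OF that] finC[OF that] finite_subset by blast
  have disj: "C \<inter> C' = {}" if "C \<in> P" "C' \<in> P" "C \<noteq> C'" for C C'
    using P that by (auto simp: partition_on_def disjoint_def)
  have collect: "(\<Sum>j<?n. h (xs ! j)) = (\<Sum>C\<in>P. \<Sum>x\<in>T C. h x)"
    if "\<And>x. x \<in> set xs \<Longrightarrow> x \<notin> (\<Union>C\<in>P. T C) \<Longrightarrow> h x = 0" for h :: "real \<Rightarrow> 'z::comm_monoid_add"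
  proof -
    have "(\<Sum>j<?n. h (xs ! j)) = sum h (set xs)" by (rule sum.reindex_bij_betw[OF bij])
    also have "\<dots> = sum h (\<Union>C\<in>P. T C)"
    proof (rule sum.mono_neutral_right)
      show "(\<Union>C\<in>P. T C) \<subseteq> set xs" using T sub by blast
      show "\<forall>x\<in>set xs - (\<Union>C\<in>P. T C). h x = 0" using that by blast
    qed simp
    also have "\<dots> = (\<Sum>C\<in>P. \<Sum>x\<in>T C. h x)"
    proof (rule sum.UNION_disjoint[OF finP])
      show "\<forall>C\<in>P. finite (T C)" using finT by blast
      show "\<forall>C\<in>P. \<forall>C'\<in>P. C \<noteq> C' \<longrightarrow> T C \<inter> T C' = {}"
      proof (intro ballI impI)
        fix C C' assume "C \<in> P" "C' \<in> P" "C \<noteq> C'"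
        then show "T C \<inter> T C' = {}" using T[of C] T[of C'] disj[of C C'] by blast
      qed
    qed
    finally show ?thesis .
  qed
  have g0: "g x = 0" if "x \<in> set xs" "x \<notin> (\<Union>C\<in>P. T C)" for x
  proof -
    obtain j where j: "j < ?n" "xs ! j = x" using \<open>x \<in> set xs\<close> by (auto simp: in_set_conv_nth)
    then have "c j = 0" using supp that by blast
    then show ?thesis using g[OF j(1)] j(2) by simp
  qed
  have split: "exp_sum (\<lambda>j. complex_of_real (c j)) ((!) xs) {..<?n} w
      = (\<Sum>C\<in>P. exp_sum g (\<lambda>x. x) (T C) w)" for w
  proof -
    have "exp_sum (\<lambda>j. complex_of_real (c j)) ((!) xs) {..<?n} w = (\<Sum>j<?n. g (xs ! j) * cis (w * xs ! j))"
      by (simp add: exp_sum_def g)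
    also have "\<dots> = (\<Sum>C\<in>P. exp_sum g (\<lambda>x. x) (T C) w)"
      unfolding exp_sum_def by (rule collect) (simp add: g0)
    finally show ?thesis .
  qed
  have norms: "(\<Sum>j<?n. (c j)\<^sup>2) = (\<Sum>C\<in>P. \<Sum>x\<in>T C. (norm (g x))\<^sup>2)"
  proof -
    have "(\<Sum>j<?n. (c j)\<^sup>2) = (\<Sum>j<?n. (norm (g (xs ! j)))\<^sup>2)" by (simp add: g)
    also have "\<dots> = (\<Sum>C\<in>P. \<Sum>x\<in>T C. (norm (g x))\<^sup>2)" by (rule collect) (simp add: g0)
    finally show ?thesis .
  qed
  define a where "a = (\<lambda>C. SOME x. x \<in> T C)"
  have a: "a C \<in> T C" if "C \<in> P" for C unfolding a_def using T[OF that] by (simp add: some_in_eq)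
  have aC: "a C \<in> C" if "C \<in> P" for C using a[OF that] T[OF that] by blast
  have "inj_on a P" using aC disj by (intro inj_onI) (metis IntI empty_iff)
  moreover have "a ` P \<subseteq> set xs" using aC sub by blast
  ultimately have "card P \<le> card (set xs)" by (intro card_inj_on_le) auto
  then have "card P \<le> ?n" using distinct_card[OF xs] by simp
  then have "real (card P) * coupling_const l * 2 \<le> real ?n * coupling_const l * 2"
    using coupling_const_pos[of l] by (intro mult_right_mono) auto
  then have cardP: "real (card P) * coupling_const l * 2 \<le> \<theta>" using \<theta>(2) by (simp add: mult_ac)
  have r: "0 \<le> ?r" "m = 1 \<or> ?r \<le> 1"
  proof -
    have "1 \<le> 16 * pi * exp (1::real)"
      using pi_gt3 exp_ge_add_one_self[of "1::real"] mult_mono[of 1 "16 * pi" 1 "exp (1::real)"] by simp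
    then show "m = 1 \<or> ?r \<le> 1" using small by (auto simp: divide_le_eq)
  qed (use \<Delta> in auto)
  have cluster: "?r ^ (2 * (m - 1)) * (\<Sum>x\<in>T C. (norm (g x))\<^sup>2) \<le> energy (exp_sum g (\<lambda>x. x) (T C))"
    if C: "C \<in> P" for C
  proof -
    have "?r ^ (2 * (m - 1)) \<le> ?r ^ (2 * (card (T C) - 1))"
    proof (cases "m = 1")
      case True
      then show ?thesis using T[OF C] by simp
    next
      case False
      then show ?thesis using r T[OF C] by (intro power_decreasing) auto
    qed
    then have "?r ^ (2 * (m - 1)) * (\<Sum>x\<in>T C. (norm (g x))\<^sup>2)
        \<le> ?r ^ (2 * (card (T C) - 1)) * (\<Sum>x\<in>T C. (norm (g x))\<^sup>2)"
      by (intro mult_right_mono sum_nonneg) auto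
    also have "\<dots> \<le> energy (exp_sum g (\<lambda>x. x) (T C))"
      using T[OF C] near[OF C] by (intro single_cluster_energy[OF finT[OF C] _ \<Delta>]) blast+
    finally show ?thesis .
  qed
  have "1 / 2 * (?r ^ (2 * (m - 1)) * (\<Sum>j<?n. (c j)\<^sup>2)) \<le> 1 / 2 * (\<Sum>C\<in>P. energy (exp_sum g (\<lambda>x. x) (T C)))"
  proof -
    have "?r ^ (2 * (m - 1)) * (\<Sum>C\<in>P. \<Sum>x\<in>T C. (norm (g x))\<^sup>2)
        = (\<Sum>C\<in>P. ?r ^ (2 * (m - 1)) * (\<Sum>x\<in>T C. (norm (g x))\<^sup>2))" by (rule sum_distrib_left)
    also have "\<dots> \<le> (\<Sum>C\<in>P. energy (exp_sum g (\<lambda>x. x) (T C)))" by (intro sum_mono cluster)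
    finally show ?thesis unfolding norms by (intro mult_left_mono) auto
  qed
  also have "\<dots> \<le> energy (\<lambda>w. \<Sum>C\<in>P. exp_sum g (\<lambda>x. x) (T C) w)"
  proof (rule energy_separated_clusters[OF finP cardP \<theta>(1) finT])
    show "card (T C) \<le> l" if "C \<in> P" for C using T[OF that] ml by linarith
    show "\<bar>x - a C\<bar> \<le> 1" if C: "C \<in> P" and x: "x \<in> T C" for C x
    proof (cases "x = a C")
      case False
      then show ?thesis using near[OF C _ aC[OF C]] T[OF C] x by blast
    qed simp
    show "\<theta> \<le> \<bar>a C - a C'\<bar>" if "C \<in> P" "C' \<in> P" "C \<noteq> C'" for C C'
      using far[OF that(1) aC[OF that(1)]] aC[OF that(2)] sub[OF that(2)] disj[OF that] by blast
  qed
  also have "\<dots> = energy (exp_sum (\<lambda>j. complex_of_real (c j)) ((!) xs) {..<?n})"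
    using split by presburger
  finally have "1 / 2 * (1 / 2 * (?r ^ (2 * (m - 1)) * (\<Sum>j<?n. (c j)\<^sup>2)))
      \<le> 1 / 2 * energy (exp_sum (\<lambda>j. complex_of_real (c j)) ((!) xs) {..<?n})"
    by (rule mult_left_mono) simp
  then show ?thesis unfolding prolate_mat_quadratic_form by (simp only: mult.assoc[symmetric])
qed

text \<open>
  On each level \<open>m\<close> the Courant-Fischer count is applied to the nodes in the chosen parts \<open>T C\<close>, which
  have \<open>min m (card C)\<close> elements.
\<close>

lemma prolate_eigenvalue_levels:
  assumes xs: "distinct xs" and conf: "clustered_config \<Delta> \<theta> s l \<tau> (set xs)"
    and \<theta>: "2 * coupling_const l * real s \<le> \<theta>" and small: "real s * \<tau> * \<Delta> \<le> 1"
    and part: "cluster_partition \<Delta> \<theta> l \<tau> (set xs) P"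
  shows "eigenvalue_levels (prolate_mat xs) l (num_clusters_ge P)
    (\<lambda>m. 1 / 4 * (\<Delta> / (16 * pi * exp 1)) ^ (2 * (m - 1)))"
proof -
  let ?A = "prolate_mat xs" and ?b = "\<lambda>m. 1 / 4 * (\<Delta> / (16 * pi * exp 1)) ^ (2 * (m - 1))"
  have \<Delta>: "\<Delta> > 0" and \<theta>0: "\<theta> > 0" and l: "1 \<le> l" "l \<le> s" "real l - 1 \<le> \<tau>"
    using conf by (auto simp: clustered_config_def)
  have len: "length xs = s" using conf distinct_card[OF xs] by (simp add: clustered_config_def)
  have P: "partition_on (set xs) P" using part by (simp add: cluster_partition_def)
  have cardl: "card C \<le> l" if "C \<in> P" for C using part that by (simp add: cluster_partition_def)
  have \<tau>\<Delta>: "\<tau> * \<Delta> \<le> 1"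
  proof -
    have "0 \<le> \<tau> * \<Delta>" using l \<Delta> by simp
    then have "1 * (\<tau> * \<Delta>) \<le> real s * (\<tau> * \<Delta>)" using l by (intro mult_right_mono) auto
    then show ?thesis using small by (simp add: mult.assoc)
  qed
  have finP: "finite P" using P by (rule finite_elements[rotated]) simp
  have disj: "C \<inter> C' = {}" if "C \<in> P" "C' \<in> P" "C \<noteq> C'" for C C'
    using P that by (auto simp: partition_on_def disjoint_def)
  have sub: "C \<subseteq> set xs" if "C \<in> P" for C using P that by (auto simp: partition_on_def)
  have finC: "finite C" if "C \<in> P" for C using sub[OF that] finite_subset by blast
  have nonempty: "card C > 0" if "C \<in> P" for C
    using finC[OF that] P that by (auto simp: partition_on_def card_gt_0_iff)
  have "(\<Sum>k=1..m. num_clusters_ge P k) \<le> size (filter_mset (\<lambda>x. x \<ge> ?b m) (eigenvalue_mset ?A))"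
    if m: "m \<in> {1..l}" for m
  proof -
    have "\<forall>C :: real set. \<exists>T. T \<subseteq> C \<and> card T = min m (card C)"
      by (metis min.cobounded2 obtain_subset_with_card_n)
    from choice[OF this] obtain T :: "real set \<Rightarrow> real set"
      where T: "\<And>C. T C \<subseteq> C" "\<And>C. card (T C) = min m (card C)" by blast
    define J where "J = {j \<in> {..<length xs}. xs ! j \<in> (\<Union>C\<in>P. T C)}"
    have "(\<Sum>k=1..m. num_clusters_ge P k) = (\<Sum>C\<in>P. card (T C))"
      by (simp only: sum_num_clusters_ge[OF finP] T(2))
    also have "\<dots> = card (\<Union>C\<in>P. T C)"
    proof (rule card_UN_disjoint[OF finP, symmetric])
      show "\<forall>C\<in>P. finite (T C)" using finite_subset[OF T(1)] finC by blast
      show "\<forall>C\<in>P. \<forall>C'\<in>P. C \<noteq> C' \<longrightarrow> T C \<inter> T C' = {}"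
      proof (intro ballI impI)
        fix C C' assume "C \<in> P" "C' \<in> P" "C \<noteq> C'"
        then show "T C \<inter> T C' = {}" using T(1)[of C] T(1)[of C'] disj[of C C'] by blast
      qed
    qed
    also have "\<dots> = card J"
    proof -
      have "inj_on ((!) xs) J" using xs by (intro inj_on_nth) (auto simp: J_def)
      moreover have "(!) xs ` J = (\<Union>C\<in>P. T C)"
      proof
        show "(\<Union>C\<in>P. T C) \<subseteq> (!) xs ` J"
        proof
          fix x assume x: "x \<in> (\<Union>C\<in>P. T C)"
          then have "x \<in> set xs" using T(1) sub by blast
          then obtain j where "j < length xs" "xs ! j = x" by (auto simp: in_set_conv_nth)
          then show "x \<in> (!) xs ` J" using x by (auto simp: J_def)
        qed
      qed (auto simp: J_def)
      ultimately show ?thesis using card_image[of "(!) xs" J] by simp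
    qed
    also have "\<dots> \<le> size (filter_mset (\<lambda>x. x \<ge> ?b m) (eigenvalue_mset ?A))"
    proof (rule courant_fischer_count[OF prolate_mat_symmetric])
      show "J \<subseteq> {..<length xs}" by (auto simp: J_def)
      fix c :: "nat \<Rightarrow> real" assume c: "\<And>j. j \<notin> J \<Longrightarrow> c j = 0"
      show "?b m * (\<Sum>j<length xs. (c j)\<^sup>2)
        \<le> (\<Sum>j<length xs. \<Sum>k<length xs. c j * c k * prolate_mat xs $$ (j, k))"
      proof (rule clustered_form_lower_bound[OF xs P \<Delta> _ _ \<theta>0 \<theta>[folded len]])
        show "T C \<subseteq> C \<and> T C \<noteq> {} \<and> card (T C) \<le> m" if "C \<in> P" for C
          using T[of C] nonempty[OF that] m by (auto simp: min_def split: if_splits)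
        show "m \<le> l" using m by simp
        \<comment> \<open>\<open>m \<ge> 2\<close> forces \<open>l \<ge> 2\<close>, so that \<open>\<tau> \<ge> 1\<close> and \<open>\<Delta> \<le> \<tau> * \<Delta> \<le> 1\<close>\<close>
        show "m = 1 \<or> \<Delta> \<le> 1"
        proof (cases "m = 1")
          case False
          then have "\<tau> \<ge> 1" using m l by auto
          then have "1 * \<Delta> \<le> \<tau> * \<Delta>" using \<Delta> by (intro mult_right_mono) auto
          then show ?thesis using \<tau>\<Delta> by simp
        qed simp
        show "c j = 0" if "j < length xs" "xs ! j \<notin> (\<Union>C\<in>P. T C)" for j
          using c that by (auto simp: J_def)
        show "\<Delta> \<le> \<bar>x - y\<bar> \<and> \<bar>x - y\<bar> \<le> 1" if "C \<in> P" "x \<in> C" "y \<in> C" "x \<noteq> y" for C x y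
          using part that \<tau>\<Delta> unfolding cluster_partition_def by force
        show "\<theta> \<le> \<bar>x - y\<bar>" if "C \<in> P" "x \<in> C" "y \<in> set xs - C" for C x y
          using part that unfolding cluster_partition_def by blast
      qed
    qed
    finally show ?thesis .
  qed
  moreover have "size (eigenvalue_mset ?A) = (\<Sum>k=1..l. num_clusters_ge P k)"
  proof -
    have "(\<Sum>k=1..l. num_clusters_ge P k) = (\<Sum>C\<in>P. card C)"
      unfolding sum_num_clusters_ge[OF finP] using cardl by (intro sum.cong) auto
    also have "\<dots> = card (\<Union>P)"
      by (rule card_Union_disjoint[symmetric]) (use finC disj in \<open>auto simp: pairwise_def disjnt_def\<close>)
    also have "\<Union>P = set xs" using P by (simp add: partition_on_def)
    finally show ?thesis
      using size_eigenvalue_mset_symmetric[OF prolate_mat_symmetric, of xs] distinct_card[OF xs] by simp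
  qed
  ultimately show "eigenvalue_levels ?A l (num_clusters_ge P) ?b"
    unfolding eigenvalue_levels_def by (rule multiset_split_levels)
qed

theorem theorem7p3:
  shows "\<exists>(C8::real) (C10 :: nat \<Rightarrow> real) (C11 :: nat \<Rightarrow> real).
    C8 > 0 \<and> (\<forall>l\<ge>1. C10 l > 0 \<and> C11 l > 0) \<and>
    (\<forall>(xs :: real list) (\<Delta>::real) (\<theta>::real) (s::nat) (l::nat) (\<tau>::real) (P :: real set set).
       distinct xs \<and> length xs = s \<and>
       clustered_config \<Delta> \<theta> s l \<tau> (set xs) \<and>
       \<theta> \<ge> C10 l * real s \<and> real s * \<tau> * \<Delta> \<le> C11 l \<and>
       cluster_partition \<Delta> \<theta> l \<tau> (set xs) P \<longrightarrow>
       eigenvalue_levels (prolate_mat xs) l (num_clusters_ge P)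
         (\<lambda>m. C8 * (\<Delta> / (16 * pi * exp 1)) ^ (2 * (m - 1))))"
proof (rule exI[of _ "1 / 4"], rule exI[of _ "\<lambda>l. 2 * coupling_const l"], rule exI[of _ "\<lambda>_. 1"],
    intro conjI allI impI)
  show "0 < (1 / 4 :: real)" "\<And>l. 0 < 2 * coupling_const l" "0 < (1 :: real)"
    using coupling_const_pos by simp_all
  fix xs :: "real list" and \<Delta> \<theta> :: real and s l :: nat and \<tau> :: real and P :: "real set set"
  assume *: "distinct xs \<and> length xs = s \<and> clustered_config \<Delta> \<theta> s l \<tau> (set xs) \<and>
       \<theta> \<ge> 2 * coupling_const l * real s \<and> real s * \<tau> * \<Delta> \<le> 1 \<and>
       cluster_partition \<Delta> \<theta> l \<tau> (set xs) P"
  show "eigenvalue_levels (prolate_mat xs) l (num_clusters_ge P)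
      (\<lambda>m. 1 / 4 * (\<Delta> / (16 * pi * exp 1)) ^ (2 * (m - 1)))"
    by (rule prolate_eigenvalue_levels) (use * in blast)+
qed

end
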